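(* Consider the Banker-OMD algorithm run on a delayed adversarial multi-armed bandit with losses in $[0,1]$. Let $\mathfrak d_t$ be the number of rounds $s<t$ whose feedback has not arrived at the beginning of round $t$, and $\mathfrak D_t=\sum_{s=1}^t\mathfrak d_s$. (1) If the action scales are $$\sigma_t=\left(\frac1{\sqrt t}+\mathfrak d_t\sqrt{\frac{\ln(\mathfrak D_t+1)}{\mathfrak D_t}}\right)^{-1},\qquad 1\le t\le T,$$ then at the end of round $T$ the total investment satisfies $B_T\le O(\sqrt T+\sqrt{D\log D})$. (2) If in addition $(\Psi,x_0)$ is $(C_1,C_2)$-regular, then with the action scales $$\sigma_t=\sqrt{\frac{C_2}{C_1}}\left(\frac1{\sqrt t}+\mathfrak d_t\sqrt{\frac{\ln(\mathfrak D_t+1)}{\mathfrak D_t}}\right)^{-1},\qquad 1\le t\le T,$$ the pseudo-regret satisfies $$\mathfrak R_T=O\left(\sqrt{C_1C_2}\,\bigl(\sqrt T+\sqrt{D\log D}\bigr)\right).$$ Here $O(\cdot)$ hides absolute constants only.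
   Context: **Notation.** $\triangle^{[K]}$ is the probability simplex in $\mathbb R^K$; $\mathbf 1_i$ is the $i$-th standard basis vector. A strictly convex $f$ on a convex domain $A\subseteq\mathbb R^K$ is Legendre if $\mathrm{int}(A)\neq\emptyset$, $f$ is differentiable on $\mathrm{int}(A)$, and $\|\nabla f(x_n)\|_2\to\infty$ whenever $x_n\in\mathrm{int}(A)$ converges to a boundary point of $\mathrm{int}(A)$. $D_f(y,x)=f(y)-f(x)-\langle\nabla f(x),y-x\rangle$ is the Bregman divergence (when $\nabla f(x)$ exists), $f^*(y)=\sup_x\{\langle y,x\rangle-f(x)\}$ the Fenchel conjugate, and $\bar f$ is the restriction of $f$ to $\triangle^{[K]}$ ($\bar f=f$ on $\triangle^{[K]}$, $+\infty$ elsewhere). **Delayed adversarial MAB.** There are $K\ge2$ arms and $T\ge1$ rounds. An oblivious adversary fixes loss vectors $l_t\in[0,1]^K$ and delays $d_t\in\{0,1,2,\dots\}$, unknown to the agent; $D=\sum_{t=1}^Td_t$. In round $t$ the agent picks $A_t\in[K]$; the feedback $(t,l_{t,A_t})$ is revealed at the end of round $t+d_t$. The pseudo-regret is $\mathfrak R_T=\max_{i\in[K]}\mathbb E[\sum_{t=1}^Tl_{t,A_t}-\sum_{t=1}^Tl_{t,i}]$. $\mathcal F_t$ is the $\sigma$-algebra generated by $A_1,\dots,A_t$ and the $l_{s,A_s}$ with $s+d_s\le t$. **Banker-OMD.** Inputs: a Legendre function $\Psi:\mathbb R_+^K\to\mathbb R$, a default action $x_0\in\triangle^{[K]}$ (at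 which $\nabla\Psi$ exists), and a rule producing action scales $\sigma_t>0$ from the information available at the beginning of round $t$. Initialize $B_0=0$. In round $t=1,\dots,T$: (i) determine $\sigma_t$ and set $v_t\leftarrow\sigma_t$; (ii) set $b_t\leftarrow\sigma_t$; successively for every $s<t$ whose feedback has arrived (i.e. $s+d_s<t$), set $\sigma_{t,s}=\min\{v_s,b_t\}$ and $b_t\leftarrow b_t-\sigma_{t,s}$; for other $s<t$ set $\sigma_{t,s}=0$; (iii) set $B_t=B_{t-1}+b_t$ and $v_s\leftarrow v_s-\sigma_{t,s}$ for all $s<t$; (iv) set $x_t=\nabla\bar\Psi^*\bigl(\sum_{s<t}\frac{\sigma_{t,s}}{\sigma_t}\nabla\Psi(z_s)+\frac{b_t}{\sigma_t}\nabla\Psi(x_0)\bigr)$, and sample and play $A_t\sim x_t$; (v) for each feedback $(s,l_{s,A_s})$ received at the end of round $t$, set $\tilde l_s=\frac{l_{s,A_s}}{x_{s,A_s}}\mathbf 1_{A_s}$ and $z_s=\nabla\bar\Psi^*(\nabla\Psi(x_s)-\frac1{\sigma_s}\tilde l_s)$. $B_T$ is called the total investment. **Regularity.** With $\tilde z_t=\nabla\Psi^*(\nabla\Psi(x_t)-\frac1{\sigma_t}\tilde l_t)$, $(\Psi,x_0)$ is $(C_1,C_2)$-regular ($C_1,C_2>0$) if $D_\Psi(y,x_0)\le C_1$ for all $y\in\triangle^{[K]}$ and $\mathbb E[\sigma_tD_\Psi(x_t,\tilde z_t)\mid\mathcal F_{t-1}]\le C_2/\sigma_t$ for all $t\in[T]$.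 **Conventions.** The term $\mathfrak d_t\sqrt{\ln(\mathfrak D_t+1)/\mathfrak D_t}$ is $0$ when $\mathfrak D_t=0$, and $D\log D$ is $0$ when $D=0$. *)

theory Defs
  imports "HOL-Analysis.Analysis" "HOL-Probability.Probability"
begin

section \<open>Convex analysis in \<open>\<real>\<^sup>K\<close>\<close>

text \<open>
  The number \<open>K\<close> of arms has to be quantified inside formulas, so that absolute constants do not
  depend on it. Therefore \<open>\<real>\<^sup>K\<close> is the space of \<^const>\<open>Euclidean_space\<close>: functions
  \<open>nat \<Rightarrow> real\<close> that vanish at all indices \<open>\<ge> K\<close>. Arms are numbered \<open>0, \<dots>, K - 1\<close>; rounds are
  numbered from 1.
\<close>

type_synonym rvec = "nat \<Rightarrow> real"

abbreviation Rspace :: "nat \<Rightarrow> rvec set" where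
  "Rspace K \<equiv> topspace (Euclidean_space K)"

definition inner_prod :: "nat \<Rightarrow> rvec \<Rightarrow> rvec \<Rightarrow> real" where
  "inner_prod K x y = (\<Sum>i<K. x i * y i)"

definition norm2 :: "nat \<Rightarrow> rvec \<Rightarrow> real" where
  "norm2 K x = L2_set x {..<K}"

definition orthant :: "nat \<Rightarrow> rvec set" where
  "orthant K = {x \<in> Rspace K. \<forall>i<K. 0 \<le> x i}"

definition prob_simplex :: "nat \<Rightarrow> rvec set" where
  "prob_simplex K = {x \<in> Rspace K. (\<forall>i<K. 0 \<le> x i) \<and> (\<Sum>i<K. x i) = 1}"

definition convex_domain :: "nat \<Rightarrow> rvec set \<Rightarrow> bool" where
  "convex_domain K A \<longleftrightarrow> A \<subseteq> Rspace K \<and>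
     (\<forall>x\<in>A. \<forall>y\<in>A. \<forall>u\<in>{0..1::real}. (\<lambda>i. u * x i + (1 - u) * y i) \<in> A)"

definition strictly_convex_on :: "rvec set \<Rightarrow> (rvec \<Rightarrow> real) \<Rightarrow> bool" where
  "strictly_convex_on A f \<longleftrightarrow>
     (\<forall>x\<in>A. \<forall>y\<in>A. \<forall>u\<in>{0<..<1::real}. x \<noteq> y \<longrightarrow>
        f (\<lambda>i. u * x i + (1 - u) * y i) < u * f x + (1 - u) * f y)"

text \<open>
  A function \<open>A \<rightarrow> \<real>\<close> is identified with its extension by \<open>\<infinity>\<close> outside \<open>A\<close>.
\<close>

definition ext :: "rvec set \<Rightarrow> (rvec \<Rightarrow> real) \<Rightarrow> rvec \<Rightarrow> ereal" where
  "ext A f x = (if x \<in> A then ereal (f x) else \<infinity>)"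

text \<open>
  \<open>g\<close> is the gradient of the extended-valued function \<open>F\<close> at \<open>x\<close>; this requires \<open>F\<close> to be finite
  in a neighbourhood of \<open>x\<close>, so \<open>x\<close> is an interior point of the domain of \<open>F\<close>.
\<close>

definition has_gradient :: "nat \<Rightarrow> (rvec \<Rightarrow> ereal) \<Rightarrow> rvec \<Rightarrow> rvec \<Rightarrow> bool" where
  "has_gradient K F g x \<longleftrightarrow>
     x \<in> Rspace K \<and> g \<in> Rspace K \<and> \<bar>F x\<bar> \<noteq> \<infinity> \<and>
     (\<forall>\<epsilon>>0. \<exists>\<delta>>0. \<forall>h\<in>Rspace K. norm2 K h < \<delta> \<longrightarrow>
        \<bar>F (\<lambda>i. x i + h i)\<bar> \<noteq> \<infinity> \<and>
        \<bar>real_of_ereal (F (\<lambda>i. x i + h i)) - real_of_ereal (F x) - inner_prod K g h\<bar>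
          \<le> \<epsilon> * norm2 K h)"

definition grad :: "nat \<Rightarrow> (rvec \<Rightarrow> ereal) \<Rightarrow> rvec \<Rightarrow> rvec" where
  "grad K F x = (THE g. has_gradient K F g x)"

definition fenchel_conj :: "nat \<Rightarrow> (rvec \<Rightarrow> ereal) \<Rightarrow> rvec \<Rightarrow> ereal" where
  "fenchel_conj K F y = (SUP x\<in>Rspace K. ereal (inner_prod K y x) - F x)"

definition legendre :: "nat \<Rightarrow> rvec set \<Rightarrow> (rvec \<Rightarrow> real) \<Rightarrow> bool" where
  "legendre K A f \<longleftrightarrow>
     convex_domain K A \<and> strictly_convex_on A f \<and>
     (let I = Euclidean_space K interior_of A in
        I \<noteq> {} \<and>
        (\<forall>x\<in>I. \<exists>g. has_gradient K (ext A f) g x) \<and>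
        (\<forall>X p. (\<forall>n::nat. X n \<in> I) \<and> p \<in> Euclidean_space K frontier_of I \<and>
               limitin (Euclidean_space K) X p sequentially \<longrightarrow>
           filterlim (\<lambda>n. norm2 K (grad K (ext A f) (X n))) at_top sequentially))"

text \<open>From here on \<open>\<Psi>\<close> is a function on the orthant; its values elsewhere are never used.\<close>

definition grad_Psi :: "nat \<Rightarrow> (rvec \<Rightarrow> real) \<Rightarrow> rvec \<Rightarrow> rvec" where
  "grad_Psi K \<Psi> = grad K (ext (orthant K) \<Psi>)"

definition grad_conj :: "nat \<Rightarrow> (rvec \<Rightarrow> real) \<Rightarrow> rvec \<Rightarrow> rvec" where
  "grad_conj K \<Psi> = grad K (fenchel_conj K (ext (orthant K) \<Psi>))"

definition grad_conj_bar :: "nat \<Rightarrow> (rvec \<Rightarrow> real) \<Rightarrow> rvec \<Rightarrow> rvec" where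
  "grad_conj_bar K \<Psi> = grad K (fenchel_conj K (ext (prob_simplex K) \<Psi>))"

definition bregman :: "nat \<Rightarrow> (rvec \<Rightarrow> real) \<Rightarrow> rvec \<Rightarrow> rvec \<Rightarrow> real" where
  "bregman K \<Psi> y x = \<Psi> y - \<Psi> x - inner_prod K (grad_Psi K \<Psi> x) (\<lambda>i. y i - x i)"


section \<open>Delayed adversarial bandits\<close>

definition bandit_losses :: "nat \<Rightarrow> nat \<Rightarrow> (nat \<Rightarrow> rvec) \<Rightarrow> bool" where
  "bandit_losses K T l \<longleftrightarrow> (\<forall>t\<in>{1..T}. \<forall>i<K. 0 \<le> l t i \<and> l t i \<le> 1)"

definition total_delay :: "nat \<Rightarrow> (nat \<Rightarrow> nat) \<Rightarrow> nat" where
  "total_delay T d = (\<Sum>t=1..T. d t)"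

definition arrived :: "(nat \<Rightarrow> nat) \<Rightarrow> nat \<Rightarrow> nat set" where
  "arrived d t = {s \<in> {1..<t}. s + d s < t}"

definition missing :: "(nat \<Rightarrow> nat) \<Rightarrow> nat \<Rightarrow> nat" where
  "missing d t = card {s \<in> {1..<t}. s \<notin> arrived d t}"

definition missing_sum :: "(nat \<Rightarrow> nat) \<Rightarrow> nat \<Rightarrow> nat" where
  "missing_sum d t = (\<Sum>s=1..t. missing d s)"


section \<open>Banker-OMD\<close>

definition banker_input :: "nat \<Rightarrow> (rvec \<Rightarrow> real) \<Rightarrow> rvec \<Rightarrow> bool" where
  "banker_input K \<Psi> x0 \<longleftrightarrow>
     legendre K (orthant K) \<Psi> \<and> x0 \<in> prob_simplex K \<and>
     (\<exists>g. has_gradient K (ext (orthant K) \<Psi>) g x0)"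

text \<open>
  The algorithm does not say in which order the arrived feedback is processed;
  \<open>ord t\<close> is an arbitrary enumeration of the arrived rounds.
\<close>

definition processing_order :: "nat \<Rightarrow> (nat \<Rightarrow> nat) \<Rightarrow> (nat \<Rightarrow> nat list) \<Rightarrow> bool" where
  "processing_order T d ord \<longleftrightarrow>
     (\<forall>t\<in>{1..T}. distinct (ord t) \<and> set (ord t) = arrived d t)"

text \<open>
  \<open>withdraw v b ss\<close> goes through the rounds in \<open>ss\<close>, taking \<open>min (v s) b\<close> from round \<open>s\<close> and
  decreasing \<open>b\<close> accordingly. It returns the amounts taken and the final value of \<open>b\<close>.
\<close>

fun withdraw :: "(nat \<Rightarrow> real) \<Rightarrow> real \<Rightarrow> nat list \<Rightarrow> (nat \<Rightarrow> real) \<times> real" where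
  "withdraw v b [] = (\<lambda>_. 0, b)"
| "withdraw v b (s # ss) =
     (let m = min (v s) b; (w, b') = withdraw v (b - m) ss in (w(s := m), b'))"

text \<open>
  \<open>savings \<sigma> ord t\<close> is \<open>v\<close> at the end of round \<open>t\<close>. The scales \<open>\<sigma>\<close> are a fixed sequence: those
  considered here depend on the delays only.
\<close>

fun savings :: "(nat \<Rightarrow> real) \<Rightarrow> (nat \<Rightarrow> nat list) \<Rightarrow> nat \<Rightarrow> nat \<Rightarrow> real" where
  "savings \<sigma> ord 0 = (\<lambda>_. 0)"
| "savings \<sigma> ord (Suc n) =
     (let v = (savings \<sigma> ord n)(Suc n := \<sigma> (Suc n));
          w = fst (withdraw v (\<sigma> (Suc n)) (ord (Suc n)))
      in (\<lambda>s. v s - w s))"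

definition sigma_part :: "(nat \<Rightarrow> real) \<Rightarrow> (nat \<Rightarrow> nat list) \<Rightarrow> nat \<Rightarrow> nat \<Rightarrow> real" where
  "sigma_part \<sigma> ord t = fst (withdraw (savings \<sigma> ord (t - 1)) (\<sigma> t) (ord t))"

definition investment :: "(nat \<Rightarrow> real) \<Rightarrow> (nat \<Rightarrow> nat list) \<Rightarrow> nat \<Rightarrow> real" where
  "investment \<sigma> ord t = snd (withdraw (savings \<sigma> ord (t - 1)) (\<sigma> t) (ord t))"

definition total_investment :: "(nat \<Rightarrow> real) \<Rightarrow> (nat \<Rightarrow> nat list) \<Rightarrow> nat \<Rightarrow> real" where
  "total_investment \<sigma> ord t = (\<Sum>s=1..t. investment \<sigma> ord s)"

definition loss_estimate :: "(nat \<Rightarrow> rvec) \<Rightarrow> nat \<Rightarrow> nat \<Rightarrow> rvec \<Rightarrow> rvec" where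
  "loss_estimate l t a x = (\<lambda>i. if i = a then l t a / x a else 0)"

text \<open>
  \<open>banker_x \<dots> \<omega> t\<close> is \<open>x\<^sub>t\<close> when the actions played are \<open>A\<^sub>s = \<omega> s\<close>. It depends on \<open>\<omega>\<close> only
  through arrived rounds, because \<^const>\<open>sigma_part\<close> vanishes at all others.
\<close>

fun banker_x :: "nat \<Rightarrow> (rvec \<Rightarrow> real) \<Rightarrow> rvec \<Rightarrow> (nat \<Rightarrow> rvec) \<Rightarrow> (nat \<Rightarrow> real) \<Rightarrow>
    (nat \<Rightarrow> nat list) \<Rightarrow> (nat \<Rightarrow> nat) \<Rightarrow> nat \<Rightarrow> rvec" where
  "banker_x K \<Psi> x0 l \<sigma> ord \<omega> t =
     grad_conj_bar K \<Psi> (\<lambda>i.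
       (\<Sum>s\<in>{1..<t}. sigma_part \<sigma> ord t s / \<sigma> t *
          (let x = banker_x K \<Psi> x0 l \<sigma> ord \<omega> s;
               z = grad_conj_bar K \<Psi>
                     (\<lambda>j. grad_Psi K \<Psi> x j - 1 / \<sigma> s * loss_estimate l s (\<omega> s) x j)
           in grad_Psi K \<Psi> z i))
       + investment \<sigma> ord t / \<sigma> t * grad_Psi K \<Psi> x0 i)"

declare banker_x.simps [simp del]

definition banker_z_tilde :: "nat \<Rightarrow> (rvec \<Rightarrow> real) \<Rightarrow> rvec \<Rightarrow> (nat \<Rightarrow> rvec) \<Rightarrow> (nat \<Rightarrow> real) \<Rightarrow>
    (nat \<Rightarrow> nat list) \<Rightarrow> (nat \<Rightarrow> nat) \<Rightarrow> nat \<Rightarrow> rvec" where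
  "banker_z_tilde K \<Psi> x0 l \<sigma> ord \<omega> t =
     (let x = banker_x K \<Psi> x0 l \<sigma> ord \<omega> t
      in grad_conj K \<Psi> (\<lambda>j. grad_Psi K \<Psi> x j - 1 / \<sigma> t * loss_estimate l t (\<omega> t) x j))"

text \<open>
  Joint law of the actions of rounds \<open>1, \<dots>, n\<close>: given the past, \<open>A\<^sub>t\<close> has distribution \<open>x\<^sub>t\<close>.
  The coordinates \<open>\<omega> s\<close> with \<open>s \<notin> {1..n}\<close> are 0 and carry no meaning.
\<close>

fun banker_law :: "nat \<Rightarrow> (rvec \<Rightarrow> real) \<Rightarrow> rvec \<Rightarrow> (nat \<Rightarrow> rvec) \<Rightarrow> (nat \<Rightarrow> real) \<Rightarrow>
    (nat \<Rightarrow> nat list) \<Rightarrow> nat \<Rightarrow> (nat \<Rightarrow> nat) pmf" where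
  "banker_law K \<Psi> x0 l \<sigma> ord 0 = return_pmf (\<lambda>_. 0)"
| "banker_law K \<Psi> x0 l \<sigma> ord (Suc n) =
     bind_pmf (banker_law K \<Psi> x0 l \<sigma> ord n) (\<lambda>\<omega>.
       map_pmf (fun_upd \<omega> (Suc n)) (embed_pmf (banker_x K \<Psi> x0 l \<sigma> ord \<omega> (Suc n))))"

definition pseudo_regret :: "nat \<Rightarrow> nat \<Rightarrow> (nat \<Rightarrow> rvec) \<Rightarrow> (nat \<Rightarrow> nat) pmf \<Rightarrow> real" where
  "pseudo_regret K T l P =
     (MAX i\<in>{..<K}. measure_pmf.expectation P
        (\<lambda>\<omega>. (\<Sum>t=1..T. l t (\<omega> t)) - (\<Sum>t=1..T. l t i)))"

definition feedback_algebra :: "(nat \<Rightarrow> rvec) \<Rightarrow> (nat \<Rightarrow> nat) \<Rightarrow> nat \<Rightarrow> (nat \<Rightarrow> nat) measure" where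
  "feedback_algebra l d t =
     sigma UNIV
       ({{\<omega>. \<omega> s = a} | s a. s \<in> {1..t}} \<union>
        {{\<omega>. l s (\<omega> s) \<in> S} | s S. 1 \<le> s \<and> s + d s \<le> t \<and> S \<in> sets borel})"

text \<open>
  Regularity refers to the run of the algorithm on the given instance with the given scales.
\<close>

definition regular :: "nat \<Rightarrow> nat \<Rightarrow> (nat \<Rightarrow> rvec) \<Rightarrow> (nat \<Rightarrow> nat) \<Rightarrow> (nat \<Rightarrow> nat list) \<Rightarrow>
    (nat \<Rightarrow> real) \<Rightarrow> (rvec \<Rightarrow> real) \<Rightarrow> rvec \<Rightarrow> real \<Rightarrow> real \<Rightarrow> bool" where
  "regular K T l d ord \<sigma> \<Psi> x0 C1 C2 \<longleftrightarrow>
     C1 > 0 \<and> C2 > 0 \<and>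
     (\<forall>y\<in>prob_simplex K. bregman K \<Psi> y x0 \<le> C1) \<and>
     (let P = measure_pmf (banker_law K \<Psi> x0 l \<sigma> ord T) in
      \<forall>t\<in>{1..T}. AE \<omega> in P.
        real_cond_exp P (feedback_algebra l d (t - 1))
          (\<lambda>\<omega>. \<sigma> t * bregman K \<Psi> (banker_x K \<Psi> x0 l \<sigma> ord \<omega> t)
                                  (banker_z_tilde K \<Psi> x0 l \<sigma> ord \<omega> t)) \<omega>
        \<le> C2 / \<sigma> t)"

end

theory Submission
  imports Defs
begin

text \<open>
  When round \<open>n\<close> has to invest fresh capital, all savings of arrived rounds are spent, so the total
  investment \<open>B\<^sub>n\<close> is at most the sum of \<open>\<sigma>\<^sub>n\<close> and the scales of the rounds missing at time \<open>n\<close>. The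
  \<open>j\<close>-th of these rounds already saw \<open>j - 1\<close> missing rounds itself, so its scale is at most about
  \<open>sqrt (D / ln D) / j\<close>, and the harmonic sum gives the bound on \<open>B\<^sub>T\<close>.

  For the regret, the mirror descent identity for each round is summed. Since the gradient of the action is a
  convex combination of gradients of earlier points, up to a multiple of the all-ones vector, the
  divergences telescope according to the bookkeeping of the savings; the divergences to \<open>x\<^sub>0\<close> contribute
  \<open>C\<^sub>1 B\<^sub>T\<close> and the local terms \<open>C\<^sub>2 / \<sigma>\<^sub>t\<close>. All this needs the points of the run to be interior, which holds
  because the gradient of a Legendre function blows up at the boundary. As \<open>\<Psi>\<close>
  may fail to be lower semicontinuous at the boundary, a limit of a minimizing sequence is first
  shown to be interior, and only then to be a minimizer.
\<close>

section \<open>Total investment\<close>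

text \<open>Behind the bound on the total investment stands a conservation law: the savings of all
  rounds always add up to the capital invested so far. It turns a quantity accumulated over the
  whole past into a sum over the few accounts that are not empty.

  The gradients of conjugates that define the run are definite descriptions, so nothing is known
  about a point of the run before the conjugate has been shown differentiable there. This takes an
  attained supremum together with a quantitative form of uniqueness, namely linear growth away from
  the maximizer.

  Regularity speaks of the conjugate of \<open>\<Psi>\<close> on the orthant, the run of the
  conjugate on the simplex. Both are instances of minimizing over a closed convex subset of the
  orthant, and a Pythagorean identity carries the bound from one to the other. Positivity of the
  minimizers is also what makes the gradient relations equalities instead of variational
  inequalities.\<close>

lemma withdraw_other: "s \<notin> set ss \<Longrightarrow> fst (withdraw v b ss) s = 0"
  by (induction ss arbitrary: b) (auto simp: Let_def case_prod_unfold)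

lemma withdraw_cong:
  "(\<And>s. s \<in> set ss \<Longrightarrow> v s = v' s) \<Longrightarrow> withdraw v b ss = withdraw v' b ss"
  by (induction ss arbitrary: b) (auto simp: Let_def)

lemma withdraw_nonneg:
  assumes "\<And>s. s \<in> set ss \<Longrightarrow> 0 \<le> v s" "0 \<le> b"
  shows "0 \<le> fst (withdraw v b ss) s" "0 \<le> snd (withdraw v b ss)"
  using assms
  by (induction ss arbitrary: b) (auto simp: Let_def case_prod_unfold)

lemma withdraw_le:
  assumes "\<And>s. s \<in> set ss \<Longrightarrow> 0 \<le> v s" "s \<in> set ss"
  shows "fst (withdraw v b ss) s \<le> v s"
  using assms
proof (induction ss arbitrary: b)
  case (Cons a ss)
  show ?case
  proof (cases "s = a")
    case False
    then show ?thesis using Cons by (auto simp: Let_def case_prod_unfold)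
  qed (auto simp: Let_def case_prod_unfold)
qed simp

lemma withdraw_sum:
  assumes "distinct ss"
  shows "(\<Sum>s\<in>set ss. fst (withdraw v b ss) s) + snd (withdraw v b ss) = b"
  using assms
proof (induction ss arbitrary: b)
  case (Cons a ss)
  obtain w b' where w: "withdraw v (b - min (v a) b) ss = (w, b')"
    by fastforce
  have "(\<Sum>s\<in>set ss. (w(a := min (v a) b)) s) = (\<Sum>s\<in>set ss. w s)"
    using Cons.prems by (intro sum.cong) auto
  then show ?case
    using Cons.IH[of "b - min (v a) b"] Cons.prems by (simp add: Let_def w)
qed simp

text \<open>If some account on the list could not be emptied, the demand was met in full at that
  place and nothing would be left over at the end.\<close>

lemma withdraw_exhausts:
  assumes "\<And>s. s \<in> set ss \<Longrightarrow> 0 \<le> v s" "0 \<le> b" "distinct ss"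
    "snd (withdraw v b ss) \<noteq> 0" "s \<in> set ss"
  shows "fst (withdraw v b ss) s = v s"
  using assms
proof (induction ss arbitrary: b)
  case (Cons a ss)
  obtain w b' where w: "withdraw v (b - min (v a) b) ss = (w, b')"
    by fastforce
  have b': "b' \<noteq> 0"
    using Cons.prems by (simp add: Let_def w)
  have nonneg: "0 \<le> fst (withdraw v (b - min (v a) b) ss) t" for t
    using Cons.prems by (intro withdraw_nonneg) auto
  show ?case
  proof (cases "s = a")
    case True
    have "0 \<le> (\<Sum>s\<in>set ss. w s)"
      using nonneg by (intro sum_nonneg) (simp add: w)
    moreover have "(\<Sum>s\<in>set ss. w s) + b' = b - min (v a) b"
      using withdraw_sum[of ss v "b - min (v a) b"] Cons.prems by (simp add: w)
    moreover have "0 \<le> b'"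
      using withdraw_nonneg(2)[of ss v "b - min (v a) b"] Cons.prems by (simp add: w)
    ultimately have "min (v a) b = v a" using b' by linarith
    then show ?thesis using True by (simp add: Let_def case_prod_unfold)
  next
    case False
    then show ?thesis
      using Cons.IH[of "b - min (v a) b"] Cons.prems b' by (auto simp: Let_def w)
  qed
qed simp

lemma arrived_subset: "arrived d t \<subseteq> {1..<t}"
  by (auto simp: arrived_def)

section \<open>Bookkeeping of the savings\<close>

locale banker_bookkeeping =
  fixes T :: nat and d :: "nat \<Rightarrow> nat" and ord :: "nat \<Rightarrow> nat list" and \<sigma> :: "nat \<Rightarrow> real"
  assumes order: "processing_order T d ord"
    and scale_pos: "\<And>t. t \<in> {1..T} \<Longrightarrow> 0 < \<sigma> t"
begin

lemma order_round:
  assumes "t \<in> {1..T}"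
  shows "distinct (ord t)" "set (ord t) = arrived d t"
  using order assms unfolding processing_order_def by auto

text \<open>\<open>savings\<close> credits round \<open>Suc n\<close> before withdrawing, while
  \<open>sigma_part\<close> withdraws from the old savings. The two agree because no round counts as
  arrived at its own beginning.\<close>

lemma savings_step:
  assumes "Suc n \<le> T"
  shows "savings \<sigma> ord (Suc n) s =
    ((savings \<sigma> ord n)(Suc n := \<sigma> (Suc n))) s - sigma_part \<sigma> ord (Suc n) s"
proof -
  have "withdraw ((savings \<sigma> ord n)(Suc n := \<sigma> (Suc n))) (\<sigma> (Suc n)) (ord (Suc n)) =
    withdraw (savings \<sigma> ord n) (\<sigma> (Suc n)) (ord (Suc n))"
    using order_round(2)[of "Suc n"] arrived_subset[of d "Suc n"] assms
    by (intro withdraw_cong) auto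
  then show ?thesis by (simp add: sigma_part_def Let_def)
qed

lemma sigma_part_unarrived:
  assumes "t \<in> {1..T}" "s \<notin> arrived d t"
  shows "sigma_part \<sigma> ord t s = 0"
  using assms order_round(2) by (simp add: sigma_part_def withdraw_other)

lemma savings_nonneg:
  assumes "n \<le> T"
  shows "0 \<le> savings \<sigma> ord n s"
  using assms
proof (induction n arbitrary: s)
  case (Suc n)
  have "sigma_part \<sigma> ord (Suc n) s \<le> savings \<sigma> ord n s"
  proof (cases "s \<in> arrived d (Suc n)")
    case True
    then show ?thesis
      using Suc order_round(2)[of "Suc n"] by (auto simp: sigma_part_def intro!: withdraw_le)
  next
    case False
    then show ?thesis using Suc by (simp add: sigma_part_unarrived)
  qed
  moreover have "sigma_part \<sigma> ord (Suc n) (Suc n) = 0"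
    using Suc.prems arrived_subset[of d "Suc n"] by (intro sigma_part_unarrived) auto
  ultimately show ?case
    using Suc.prems scale_pos[of "Suc n"] by (auto simp: savings_step simp del: savings.simps)
qed simp

lemma sigma_part_nonneg:
  assumes "t \<in> {1..T}"
  shows "0 \<le> sigma_part \<sigma> ord t s"
  unfolding sigma_part_def using assms scale_pos[OF assms] savings_nonneg[of "t - 1"]
  by (intro withdraw_nonneg) auto

lemma investment_nonneg:
  assumes "t \<in> {1..T}"
  shows "0 \<le> investment \<sigma> ord t"
  unfolding investment_def using assms scale_pos[OF assms] savings_nonneg[of "t - 1"]
  by (intro withdraw_nonneg) auto

lemma sigma_part_sum:
  assumes "t \<in> {1..T}"
  shows "(\<Sum>s\<in>{1..<t}. sigma_part \<sigma> ord t s) + investment \<sigma> ord t = \<sigma> t"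
proof -
  have "(\<Sum>s\<in>{1..<t}. sigma_part \<sigma> ord t s) = (\<Sum>s\<in>set (ord t). sigma_part \<sigma> ord t s)"
    using assms order_round(2)[OF assms] arrived_subset[of d t]
    by (intro sum.mono_neutral_right) (auto intro!: sigma_part_unarrived)
  then show ?thesis
    using withdraw_sum[OF order_round(1)[OF assms]]
    by (simp add: sigma_part_def investment_def)
qed

lemma savings_closed_form:
  assumes "n \<le> T" "s \<in> {1..n}"
  shows "savings \<sigma> ord n s = \<sigma> s - (\<Sum>t\<in>{s<..n}. sigma_part \<sigma> ord t s)"
  using assms
proof (induction n)
  case (Suc n)
  show ?case
  proof (cases "s = Suc n")
    case True
    have "sigma_part \<sigma> ord (Suc n) (Suc n) = 0"
      using Suc.prems arrived_subset[of d "Suc n"] by (intro sigma_part_unarrived) auto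
    then show ?thesis
      using Suc.prems True by (simp add: savings_step del: savings.simps)
  next
    case False
    then have "{s<..Suc n} = insert (Suc n) {s<..n}" using Suc.prems by auto
    then show ?thesis
      using Suc False by (simp add: savings_step del: savings.simps)
  qed
qed simp

text \<open>The account of round \<open>s\<close> is never overdrawn. This is what makes the
  divergences to the point computed from its feedback telescope in the regret.\<close>

lemma sigma_part_total_le:
  assumes "s \<in> {1..T}"
  shows "(\<Sum>t\<in>{s<..T}. sigma_part \<sigma> ord t s) \<le> \<sigma> s"
  using savings_closed_form[of T s] savings_nonneg[of T s] assms by simp

lemma savings_le_scale:
  assumes "n \<le> T" "s \<in> {1..n}"
  shows "savings \<sigma> ord n s \<le> \<sigma> s"
proof -
  have "0 \<le> (\<Sum>t\<in>{s<..n}. sigma_part \<sigma> ord t s)"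
    using assms by (intro sum_nonneg sigma_part_nonneg) auto
  then show ?thesis using savings_closed_form[OF assms] by simp
qed

text \<open>A round deposits its scale and withdraws all of it except the fresh investment, so the
  balance grows by exactly the fresh investment.\<close>

lemma savings_total:
  assumes "n \<le> T"
  shows "(\<Sum>s=1..n. savings \<sigma> ord n s) = total_investment \<sigma> ord n"
  using assms
proof (induction n)
  case (Suc n)
  have "sigma_part \<sigma> ord (Suc n) (Suc n) = 0"
    using Suc.prems arrived_subset[of d "Suc n"] by (intro sigma_part_unarrived) auto
  then have "(\<Sum>s=1..Suc n. savings \<sigma> ord (Suc n) s) =
      (\<Sum>s=1..n. savings \<sigma> ord n s) - (\<Sum>s=1..n. sigma_part \<sigma> ord (Suc n) s) + \<sigma> (Suc n)"
    using Suc.prems by (simp add: savings_step sum_subtractf del: savings.simps)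
  also have "\<dots> = total_investment \<sigma> ord n + investment \<sigma> ord (Suc n)"
    using Suc sigma_part_sum[of "Suc n"] by (simp add: atLeastLessThanSuc_atLeastAtMost)
  finally show ?case by (simp add: total_investment_def)
qed (simp add: total_investment_def)

lemma total_investment_le:
  assumes "n \<le> T" "0 \<le> M"
    and "\<And>t. t \<in> {1..T} \<Longrightarrow> \<sigma> t + (\<Sum>s | s \<in> {1..<t} \<and> s \<notin> arrived d t. \<sigma> s) \<le> M"
  shows "total_investment \<sigma> ord n \<le> M"
  using assms(1)
proof (induction n)
  case (Suc n)
  let ?t = "Suc n"
  have t: "?t \<in> {1..T}" using Suc.prems by auto
  \<comment> \<open>A round without fresh investment leaves the total unchanged, so the bound is
    inherited even though arrived accounts may then still hold savings.\<close>
  show ?case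
  proof (cases "investment \<sigma> ord ?t = 0")
    case True
    then show ?thesis using Suc by (simp add: total_investment_def)
  next
    case False
    have spent: "savings \<sigma> ord ?t s = 0" if "s \<in> arrived d ?t" for s
    proof -
      have "sigma_part \<sigma> ord ?t s = savings \<sigma> ord n s"
        using False that Suc.prems savings_nonneg[of n] scale_pos[OF t] order_round[OF t]
        unfolding sigma_part_def investment_def diff_Suc_1
        by (intro withdraw_exhausts) auto
      moreover have "s \<noteq> ?t" using that arrived_subset[of d ?t] by auto
      ultimately show ?thesis using Suc.prems by (simp add: savings_step del: savings.simps)
    qed
    have "total_investment \<sigma> ord ?t = (\<Sum>s=1..?t. savings \<sigma> ord ?t s)"
      using savings_total[OF Suc.prems] by simp
    also have "\<dots> = savings \<sigma> ord ?t ?t + (\<Sum>s\<in>{1..<?t}. savings \<sigma> ord ?t s)"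
      by (simp add: atLeastLessThanSuc_atLeastAtMost del: savings.simps)
    also have "(\<Sum>s\<in>{1..<?t}. savings \<sigma> ord ?t s) =
        (\<Sum>s | s \<in> {1..<?t} \<and> s \<notin> arrived d ?t. savings \<sigma> ord ?t s)"
      using spent by (intro sum.mono_neutral_right) (auto simp del: savings.simps)
    also have "savings \<sigma> ord ?t ?t + \<dots> \<le>
        \<sigma> ?t + (\<Sum>s | s \<in> {1..<?t} \<and> s \<notin> arrived d ?t. \<sigma> s)"
      using Suc.prems by (intro add_mono sum_mono savings_le_scale) auto
    also have "\<dots> \<le> M" by (rule assms(3)[OF t])
    finally show ?thesis .
  qed
qed (simp add: total_investment_def assms(2))

end

section \<open>Counting missing rounds and estimating the scales\<close>

lemma missing_sum_le_total_delay: "missing_sum d T \<le> total_delay T d"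
proof -
  \<comment> \<open>Double counting of the pairs of a round \<open>s\<close> and a later round
    \<open>t\<close> in which it is missing: such \<open>t\<close> satisfy
    \<open>s < t \<le> s + d s\<close>, so each \<open>s\<close> occurs at most \<open>d s\<close>
    times.\<close>
  have "missing_sum d T = (\<Sum>t=1..T. \<Sum>s | s \<in> {1..T} \<and> s < t \<and> t \<le> s + d s. 1)"
    unfolding missing_sum_def missing_def arrived_def
    by (intro sum.cong) (auto intro!: arg_cong[where f = card])
  also have "\<dots> = (\<Sum>s=1..T. \<Sum>t | t \<in> {1..T} \<and> s < t \<and> t \<le> s + d s. 1)"
    by (rule sum.swap_restrict) auto
  also have "\<dots> \<le> (\<Sum>s=1..T. d s)"
  proof (rule sum_mono)
    fix s
    have "card {t. t \<in> {1..T} \<and> s < t \<and> t \<le> s + d s} \<le> card {s<..s + d s}"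
      by (intro card_mono) auto
    then show "(\<Sum>t | t \<in> {1..T} \<and> s < t \<and> t \<le> s + d s. 1) \<le> d s" by simp
  qed
  finally show ?thesis by (simp add: total_delay_def)
qed

lemma missing_sum_mono: "s \<le> t \<Longrightarrow> missing_sum d s \<le> missing_sum d t"
  unfolding missing_sum_def by (intro sum_mono2) auto

lemma missing_le_missing_sum: "1 \<le> t \<Longrightarrow> missing d t \<le> missing_sum d t"
  unfolding missing_sum_def by (intro member_le_sum) auto

text \<open>The k-th smallest element contributes at most \<open>C / (k - 1)\<close>; the smallest,
  for which this says nothing, at most \<open>A\<close>. The factor 2 arises because
  \<open>ln (n + 1) - ln n\<close> is compared with \<open>1 / (n + 1)\<close> instead of
  \<open>1 / n\<close>, and \<open>max 1\<close> covers the empty set.\<close>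

lemma sum_le_harmonic:
  fixes f :: "nat \<Rightarrow> real"
  assumes "finite M" "0 \<le> C" "0 \<le> A"
    and "\<And>s. s \<in> M \<Longrightarrow> f s \<le> A"
    and "\<And>s. s \<in> M \<Longrightarrow> {r \<in> M. r < s} \<noteq> {} \<Longrightarrow> f s \<le> C / real (card {r \<in> M. r < s})"
  shows "sum f M \<le> A + 2 * C * ln (max 1 (real (card M)))"
  using assms(1,4,5)
proof (induction M rule: finite_linorder_max_induct)
  case empty
  then show ?case using assms(3) by simp
next
  case (insert b N)
  have below: "{r \<in> insert b N. r < b} = N" using insert.hyps by auto
  have same: "{r \<in> insert b N. r < s} = {r \<in> N. r < s}" if "s \<in> N" for s
    using insert.hyps that by auto
  have IH: "sum f N \<le> A + 2 * C * ln (max 1 (real (card N)))"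
  proof (rule insert.IH)
    show "f s \<le> C / real (card {r \<in> N. r < s})" if "s \<in> N" "{r \<in> N. r < s} \<noteq> {}" for s
      using insert.prems(2)[of s] that by (simp only: same) simp
  qed (use insert.prems in auto)
  show ?case
  proof (cases "N = {}")
    case True
    then show ?thesis using insert.prems(1)[of b] by simp
  next
    case False
    define n where "n = card N"
    have n: "n \<ge> 1" using False insert.hyps by (simp add: n_def Suc_le_eq card_gt_0_iff)
    have "ln (real n / real (n + 1)) \<le> real n / real (n + 1) - 1"
      using n by (intro ln_le_minus_one) auto
    then have ln_step: "1 / real (n + 1) \<le> ln (real (n + 1)) - ln (real n)"
      using n by (simp add: ln_div field_simps)
    have "1 / real n \<le> 2 * (1 / real (n + 1))" using n by (simp add: field_simps)
    also have "\<dots> \<le> 2 * (ln (real (n + 1)) - ln (real n))"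
      by (intro mult_left_mono ln_step) auto
    finally have "1 / real n \<le> 2 * (ln (real (n + 1)) - ln (real n))" .
    from mult_left_mono[OF this assms(2)]
    have "C / real n \<le> C * (2 * (ln (real (n + 1)) - ln (real n)))" by simp
    moreover have "f b \<le> C / real n"
      using insert.prems(2)[of b] False unfolding below n_def by blast
    moreover have "sum f (insert b N) = f b + sum f N"
      using insert.hyps by (intro sum.insert) auto
    moreover have "sum f N \<le> A + 2 * C * ln (real n)"
      using IH n by (simp add: n_def[symmetric])
    ultimately have "sum f (insert b N) \<le>
        A + 2 * C * ln (real n) + 2 * C * (ln (real (n + 1)) - ln (real n))"
      by (simp add: algebra_simps)
    moreover have "card (insert b N) = n + 1" using insert.hyps n_def by auto
    ultimately show ?thesis using n by (simp add: algebra_simps)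
  qed
qed

text \<open>Concavity of \<open>ln\<close> together with \<open>ln 1 = 0\<close>: the point
  \<open>x + 1\<close> is the convex combination of \<open>1\<close> and \<open>y + 1\<close> with
  weight \<open>x / y\<close>.\<close>

lemma div_ln_mono:
  fixes x y :: real
  assumes "0 < x" "x \<le> y"
  shows "x / ln (x + 1) \<le> y / ln (y + 1)"
proof -
  have "ln ((1 - x / y) * 1 + (x / y) * (y + 1)) \<ge> (1 - x / y) * ln 1 + (x / y) * ln (y + 1)"
    using assms concave_onD[OF ln_concave, of "x / y" 1 "y + 1"] by auto
  moreover have "(1 - x / y) * 1 + (x / y) * (y + 1) = x + 1" using assms by (simp add: field_simps)
  ultimately have "(x / y) * ln (y + 1) \<le> ln (x + 1)" by (metis add_0 ln_one mult_zero_right)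
  moreover have "0 < ln (x + 1)" "0 < ln (y + 1)" using assms by auto
  ultimately show ?thesis using assms by (simp add: field_simps)
qed

text \<open>The scales lead to \<open>ln (D + 1)\<close>, the claim has \<open>ln D\<close>. For
  \<open>D \<ge> 2\<close> the shift costs a constant because \<open>D + 1 \<le> D^2\<close>; for
  \<open>D = 1\<close> the logarithm on the right vanishes and \<open>sqrt T\<close> has to
  pay.\<close>

lemma sqrt_log_shift_le:
  assumes "1 \<le> T"
  shows "sqrt (real D * ln (real D + 1)) \<le> 2 * (sqrt (real T) + sqrt (real D * ln (real D)))"
proof -
  consider "D = 0" | "D = 1" | "2 \<le> D" by linarith
  then show ?thesis
  proof cases
    case 2
    have "ln (2::real) \<le> 1" using ln_le_minus_one[of 2] by simp
    moreover have "1 \<le> sqrt (real T)" using assms by simp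
    ultimately show ?thesis using 2 by (simp add: real_le_lsqrt)
  next
    case 3
    have "real D + 1 \<le> real D ^ 2"
    proof -
      have "2 * real D \<le> real D * real D" using 3 by (intro mult_right_mono) auto
      moreover have "1 \<le> real D" using 3 by simp
      ultimately show ?thesis unfolding power2_eq_square by linarith
    qed
    then have "ln (real D + 1) \<le> ln (real D ^ 2)" using 3 by (subst ln_le_cancel_iff) auto
    also have "\<dots> = 2 * ln (real D)" using 3 by (simp add: ln_realpow)
    \<comment> \<open>Doubling once more makes the constant a perfect square.\<close>
    also have "\<dots> \<le> 4 * ln (real D)" using 3 by simp
    finally have "real D * ln (real D + 1) \<le> 4 * (real D * ln (real D))"
      using 3 by simp
    then have "sqrt (real D * ln (real D + 1)) \<le> sqrt (4 * (real D * ln (real D)))"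
      by (rule real_sqrt_le_mono)
    also have "\<dots> = 2 * sqrt (real D * ln (real D))" by (simp add: real_sqrt_mult)
    finally show ?thesis by (simp add: add_increasing)
  qed simp_all
qed

text \<open>The inverse of the action scale up to normalization. Division by 0 yields 0, so the
  second summand vanishes as long as no round has been missing, in accordance with the
  convention.\<close>

abbreviation (input) rate :: "(nat \<Rightarrow> nat) \<Rightarrow> nat \<Rightarrow> real" where
  "rate d t \<equiv> 1 / sqrt (real t) + real (missing d t) *
     sqrt (ln (real (missing_sum d t) + 1) / real (missing_sum d t))"

lemma rate_ge:
  "1 / sqrt (real t) \<le> rate d t"
  "real (missing d t) * sqrt (ln (real (missing_sum d t) + 1) / real (missing_sum d t)) \<le> rate d t"
  by auto

lemma rate_pos: "1 \<le> t \<Longrightarrow> 0 < rate d t"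
  by (intro add_pos_nonneg) auto

lemma inverse_rate_le_sqrt: "1 \<le> t \<Longrightarrow> inverse (rate d t) \<le> sqrt (real t)"
  using le_imp_inverse_le[OF rate_ge(1)[of t d]] by simp

text \<open>Only the delay term of the rate is kept, and monotonicity of
  \<open>x / ln (x + 1)\<close> replaces the running count of missing rounds by the total delay. The
  parameter \<open>m\<close> admits any positive lower bound on the number of missing
  rounds.\<close>

lemma inverse_rate_le:
  fixes d :: "nat \<Rightarrow> nat"
  assumes "t \<in> {1..T}" "0 < m" "m \<le> missing d t"
  defines "D \<equiv> real (total_delay T d)"
  shows "inverse (rate d t) \<le> sqrt (D / ln (D + 1)) / real m"
proof -
  define S where "S = real (missing_sum d t)"
  have S: "0 < S" "S \<le> D"
    using assms(1-3) missing_le_missing_sum[of t d] missing_sum_mono[of t T d]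
      missing_sum_le_total_delay[of d T] unfolding S_def D_def by auto
  have pos: "0 < sqrt (ln (S + 1) / S)" using S by simp
  have "real m * sqrt (ln (S + 1) / S) \<le> real (missing d t) * sqrt (ln (S + 1) / S)"
    using assms(3) pos by (intro mult_right_mono) auto
  also have "\<dots> \<le> rate d t" using rate_ge(2)[of d t] by (simp add: S_def)
  finally have "inverse (rate d t) \<le> inverse (real m * sqrt (ln (S + 1) / S))"
    using pos assms(2) by (intro le_imp_inverse_le) auto
  also have "\<dots> = sqrt (S / ln (S + 1)) / real m"
    by (simp add: real_sqrt_divide field_simps)
  also have "\<dots> \<le> sqrt (D / ln (D + 1)) / real m"
    using div_ln_mono[OF S] by (intro divide_right_mono) auto
  finally show ?thesis .
qed

lemma sum_missing_le:
  fixes d :: "nat \<Rightarrow> nat"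
  assumes t: "t \<in> {1..T}"
  defines "D \<equiv> real (total_delay T d)"
  shows "(\<Sum>s | s \<in> {1..<t} \<and> s \<notin> arrived d t. inverse (rate d s)) \<le>
    sqrt (real T) + 2 * sqrt (D * ln (D + 1))"
proof -
  define M where "M = {s. s \<in> {1..<t} \<and> s \<notin> arrived d t}"
  have fin: "finite M" by (simp add: M_def)
  have sub: "s \<in> {1..T}" if "s \<in> M" for s using that t by (auto simp: M_def)
  \<comment> \<open>A round \<open>r < s\<close> of \<open>M\<close> is still missing at the later
    time \<open>t\<close>, so it was missing at \<open>s\<close> as well.\<close>
  have nest: "card {r \<in> M. r < s} \<le> missing d s" if "s \<in> M" for s
    unfolding missing_def using that by (intro card_mono) (auto simp: M_def arrived_def)
  \<comment> \<open>The oldest missing round need not have seen any missing round itself. Its scale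
    is bounded by \<open>sqrt T\<close>, which enters as the additive constant of the harmonic
    estimate.\<close>
  have 1: "(\<Sum>s\<in>M. inverse (rate d s)) \<le>
      sqrt (real T) + 2 * sqrt (D / ln (D + 1)) * ln (max 1 (real (card M)))"
  proof (rule sum_le_harmonic[OF fin])
    show "inverse (rate d s) \<le> sqrt (real T)" if "s \<in> M" for s
      using inverse_rate_le_sqrt[of s d] sub[OF that]
      by (auto intro: order_trans[where y = "sqrt (real s)"])
    show "inverse (rate d s) \<le> sqrt (D / ln (D + 1)) / real (card {r \<in> M. r < s})"
      if "s \<in> M" "{r \<in> M. r < s} \<noteq> {}" for s
      unfolding D_def using that fin nest[of s] sub[of s]
      by (intro inverse_rate_le) (auto simp: card_gt_0_iff)
  qed (auto simp: D_def)
  have "card M = missing d t" by (simp add: M_def missing_def)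
  then have "real (card M) \<le> D"
    using missing_le_missing_sum[of t d] missing_sum_mono[of t T d]
      missing_sum_le_total_delay[of d T] t unfolding D_def by auto
  then have "ln (max 1 (real (card M))) \<le> ln (D + 1)"
    by (subst ln_le_cancel_iff) (auto simp: D_def)
  then have "sqrt (D / ln (D + 1)) * ln (max 1 (real (card M))) \<le> sqrt (D / ln (D + 1)) * ln (D + 1)"
    by (intro mult_left_mono) (auto simp: D_def)
  also have "\<dots> = sqrt (D * ln (D + 1))"
  proof -
    have "sqrt (D / ln (D + 1)) * ln (D + 1) = sqrt (D / ln (D + 1) * (ln (D + 1))\<^sup>2)"
      unfolding real_sqrt_mult by (simp add: D_def)
    then show ?thesis by (simp add: power2_eq_square)
  qed
  finally show ?thesis using 1 unfolding M_def by linarith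
qed

context banker_bookkeeping
begin

text \<open>The constant 6 consists of 1 for the scale of the round itself, 1 for the oldest missing
  round and 4 for the harmonic sum after passing from \<open>ln (D + 1)\<close> to
  \<open>ln D\<close>.\<close>

lemma total_investment_rate:
  assumes T: "1 \<le> T" and "0 < \<kappa>"
    and \<sigma>: "\<And>t. t \<in> {1..T} \<Longrightarrow> \<sigma> t = \<kappa> * inverse (rate d t)"
  shows "total_investment \<sigma> ord T \<le>
    \<kappa> * (6 * (sqrt (real T) + sqrt (real (total_delay T d) * ln (real (total_delay T d)))))"
proof (rule total_investment_le[OF order_refl])
  let ?D = "real (total_delay T d)"
  show "0 \<le> \<kappa> * (6 * (sqrt (real T) + sqrt (?D * ln ?D)))"
    using assms(2) by (cases "total_delay T d = 0") auto
  fix t assume t: "t \<in> {1..T}"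
  have "\<sigma> t \<le> \<kappa> * sqrt (real T)"
    using assms(2) t inverse_rate_le_sqrt[of t d] unfolding \<sigma>[OF t]
    by (intro mult_left_mono) (auto intro: order_trans[where y = "sqrt (real t)"])
  moreover have "(\<Sum>s | s \<in> {1..<t} \<and> s \<notin> arrived d t. \<sigma> s) =
      \<kappa> * (\<Sum>s | s \<in> {1..<t} \<and> s \<notin> arrived d t. inverse (rate d s))"
    unfolding sum_distrib_left using t by (intro sum.cong \<sigma>) auto
  moreover have "\<dots> \<le> \<kappa> * (sqrt (real T) + 2 * sqrt (?D * ln (?D + 1)))"
    using assms(2) sum_missing_le[OF t, of d] by (intro mult_left_mono) auto
  moreover have "\<kappa> * (2 * sqrt (?D * ln (?D + 1))) \<le> \<kappa> * (4 * (sqrt (real T) + sqrt (?D * ln ?D)))"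
    using assms(2) sqrt_log_shift_le[OF T, of "total_delay T d"] by (intro mult_left_mono) auto
  moreover have "0 \<le> \<kappa> * sqrt (?D * ln ?D)"
    using assms(2) by (cases "total_delay T d = 0") auto
  ultimately show "\<sigma> t + (\<Sum>s | s \<in> {1..<t} \<and> s \<notin> arrived d t. \<sigma> s) \<le>
      \<kappa> * (6 * (sqrt (real T) + sqrt (?D * ln ?D)))"
    by (simp add: algebra_simps)
qed

end

text \<open>For consecutive partial sums \<open>S \<le> S'\<close> the summand is at most
  \<open>2 * (sqrt S' - sqrt S)\<close>, so the sum telescopes. It is applied with all terms equal
  to 1 and with the numbers of missing rounds.\<close>

lemma sum_div_sqrt_partial_sums_le:
  fixes a :: "nat \<Rightarrow> nat"
  shows "(\<Sum>t=1..n. real (a t) / sqrt (real (\<Sum>s=1..t. a s))) \<le> 2 * sqrt (real (\<Sum>s=1..n. a s))"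
proof (induction n)
  case (Suc n)
  define S where "S = real (\<Sum>s=1..n. a s)"
  define x where "x = real (a (Suc n))"
  have nn: "0 \<le> S" "0 \<le> x" unfolding S_def x_def by (rule of_nat_0_le_iff)+
  have "2 * sqrt S + x / sqrt (S + x) \<le> 2 * sqrt (S + x)"
  proof (cases "S + x = 0")
    case False
    then have pos: "0 < sqrt (S + x)" using nn by simp
    have "2 * (sqrt S * sqrt (S + x)) \<le> sqrt S ^ 2 + sqrt (S + x) ^ 2"
      using sum_squares_bound[of "sqrt S" "sqrt (S + x)"] by simp
    then have "2 * (sqrt S * sqrt (S + x)) + x \<le> 2 * (sqrt (S + x) * sqrt (S + x))"
      using nn by simp
    then show ?thesis using pos by (simp add: field_simps)
  qed (use nn in simp)
  then show ?case using Suc by (simp add: S_def x_def)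
qed simp

text \<open>Up to a factor this is the sum of the local terms \<open>C2 / \<sigma> t\<close> of the
  regret. The logarithm is taken out at its final, largest value; what remains are counts divided by
  roots of their partial sums.\<close>

lemma sum_rate_le:
  assumes T: "1 \<le> T"
  shows "(\<Sum>t=1..T. rate d t) \<le>
    6 * (sqrt (real T) + sqrt (real (total_delay T d) * ln (real (total_delay T d))))"
proof -
  let ?D = "real (total_delay T d)"
  define S where "S t = real (missing_sum d t)" for t
  have "(\<Sum>t=1..T. 1 / sqrt (real t)) \<le> 2 * sqrt (real T)"
    using sum_div_sqrt_partial_sums_le[where a = "\<lambda>_. 1" and n = T] by simp
  moreover have "(\<Sum>t=1..T. real (missing d t) * sqrt (ln (S t + 1) / S t)) \<le>
      (\<Sum>t=1..T. sqrt (ln (S T + 1)) * (real (missing d t) / sqrt (S t)))"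
  proof (rule sum_mono)
    fix t assume "t \<in> {1..T}"
    then have "ln (S t + 1) \<le> ln (S T + 1)"
      using missing_sum_mono[of t T d] by (simp add: S_def)
    then have "sqrt (ln (S t + 1)) * (real (missing d t) / sqrt (S t)) \<le>
        sqrt (ln (S T + 1)) * (real (missing d t) / sqrt (S t))"
      by (intro mult_right_mono) (auto simp: S_def)
    then show "real (missing d t) * sqrt (ln (S t + 1) / S t) \<le>
        sqrt (ln (S T + 1)) * (real (missing d t) / sqrt (S t))"
      by (simp add: real_sqrt_divide mult.commute)
  qed
  moreover have "\<dots> \<le> sqrt (ln (S T + 1)) * (2 * sqrt (S T))"
    unfolding sum_distrib_left[symmetric]
    using sum_div_sqrt_partial_sums_le[where a = "missing d" and n = T]
    by (intro mult_left_mono) (simp_all only: S_def missing_sum_def, simp flip: of_nat_sum)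
  moreover have "sqrt (ln (S T + 1)) * (2 * sqrt (S T)) \<le> 2 * sqrt (?D * ln (?D + 1))"
  proof -
    have "S T \<le> ?D" using missing_sum_le_total_delay[of d T] by (simp add: S_def)
    moreover from this have "ln (S T + 1) \<le> ln (?D + 1)" by (simp add: S_def)
    ultimately have "S T * ln (S T + 1) \<le> ?D * ln (?D + 1)"
      by (intro mult_mono) (auto simp: S_def)
    then show ?thesis by (simp add: mult.commute flip: real_sqrt_mult)
  qed
  moreover have "2 * sqrt (?D * ln (?D + 1)) \<le> 4 * (sqrt (real T) + sqrt (?D * ln ?D))"
    using sqrt_log_shift_le[OF T, of "total_delay T d"] by simp
  moreover have "0 \<le> sqrt (?D * ln ?D)" by (cases "total_delay T d = 0") auto
  moreover have "(\<Sum>t=1..T. rate d t) = (\<Sum>t=1..T. 1 / sqrt (real t)) +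
      (\<Sum>t=1..T. real (missing d t) * sqrt (ln (S t + 1) / S t))"
    unfolding S_def by (rule sum.distrib)
  ultimately show ?thesis unfolding distrib_left by linarith
qed

section \<open>Legendre functions on the orthant\<close>

lemma Rspace_iff: "x \<in> Rspace K \<longleftrightarrow> (\<forall>i\<ge>K. x i = 0)"
  by (simp add: topspace_Euclidean_space)

lemma inner_prod_commute: "inner_prod K x y = inner_prod K y x"
  by (simp add: inner_prod_def mult.commute)

lemma inner_prod_left:
  "inner_prod K (\<lambda>i. x i + y i) z = inner_prod K x z + inner_prod K y z"
  "inner_prod K (\<lambda>i. x i - y i) z = inner_prod K x z - inner_prod K y z"
  "inner_prod K (\<lambda>i. c * x i) z = c * inner_prod K x z"
  by (simp_all add: inner_prod_def algebra_simps sum.distrib sum_subtractf sum_distrib_left)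

lemma inner_prod_right:
  "inner_prod K z (\<lambda>i. x i + y i) = inner_prod K z x + inner_prod K z y"
  "inner_prod K z (\<lambda>i. x i - y i) = inner_prod K z x - inner_prod K z y"
  "inner_prod K z (\<lambda>i. c * x i) = c * inner_prod K z x"
  by (simp_all add: inner_prod_commute[of K z] inner_prod_left)

lemma inner_prod_sum_left:
  "inner_prod K (\<lambda>i. \<Sum>s\<in>A. f s i) z = (\<Sum>s\<in>A. inner_prod K (f s) z)"
  by (simp add: inner_prod_def sum_distrib_right) (rule sum.swap)

lemma inner_prod_single:
  assumes "i < K"
  shows "inner_prod K x (\<lambda>j. if j = i then c else 0) = x i * c"
proof -
  have "inner_prod K x (\<lambda>j. if j = i then c else 0) = (\<Sum>j<K. if j = i then x i * c else 0)"
    unfolding inner_prod_def by (intro sum.cong) auto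
  then show ?thesis using assms by simp
qed

lemma norm2_nonneg [simp]: "0 \<le> norm2 K x"
  by (simp add: norm2_def)

lemma norm2_power2: "(norm2 K x)\<^sup>2 = inner_prod K x x"
  by (simp add: norm2_def L2_set_def inner_prod_def sum_nonneg power2_eq_square)

lemma inner_prod_le_norm2: "\<bar>inner_prod K x y\<bar> \<le> norm2 K x * norm2 K y"
proof -
  have "\<bar>inner_prod K x y\<bar> \<le> (\<Sum>i<K. \<bar>x i\<bar> * \<bar>y i\<bar>)"
    unfolding inner_prod_def by (rule order_trans[OF sum_abs]) (simp add: abs_mult)
  also have "\<dots> \<le> norm2 K x * norm2 K y"
    unfolding norm2_def by (rule L2_set_mult_ineq)
  finally show ?thesis .
qed

lemma norm2_scale: "norm2 K (\<lambda>i. c * x i) = \<bar>c\<bar> * norm2 K x"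
  by (simp add: norm2_def L2_set_def power_mult_distrib real_sqrt_mult flip: sum_distrib_left)

lemma norm2_component_le: "i < K \<Longrightarrow> \<bar>x i\<bar> \<le> norm2 K x"
  using member_le_L2_set[of "{..<K}" i "\<lambda>i. \<bar>x i\<bar>"] by (simp add: norm2_def L2_set_def)

lemma norm2_le_sum: "norm2 K x \<le> (\<Sum>i<K. \<bar>x i\<bar>)"
  unfolding norm2_def by (rule L2_set_le_sum_abs)

lemma norm2_eq_0D:
  assumes "norm2 K x = 0" "x \<in> Rspace K"
  shows "x i = 0"
  using assms norm2_component_le[of i K x] by (cases "i < K") (auto simp: Rspace_iff)

lemma tendsto_norm2:
  assumes "\<And>i. i < K \<Longrightarrow> (\<lambda>n. X n i) \<longlonglongrightarrow> p i"
  shows "(\<lambda>n. norm2 K (X n)) \<longlonglongrightarrow> norm2 K p"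
  unfolding norm2_def L2_set_def using assms by (intro tendsto_intros) auto

lemma tendsto_inner_prod:
  assumes "\<And>i. i < K \<Longrightarrow> (\<lambda>n. X n i) \<longlonglongrightarrow> p i"
  shows "(\<lambda>n. inner_prod K y (X n)) \<longlonglongrightarrow> inner_prod K y p"
  unfolding inner_prod_def using assms by (intro tendsto_intros) auto

lemma bounded_sequence_convergent_subsequence:
  fixes X :: "nat \<Rightarrow> rvec"
  assumes "\<And>n i. i < K \<Longrightarrow> \<bar>X n i\<bar> \<le> R"
  obtains r p where "strict_mono (r :: nat \<Rightarrow> nat)" "p \<in> Rspace K"
    "\<And>i. i < K \<Longrightarrow> (\<lambda>n. X (r n) i) \<longlonglongrightarrow> p i"
proof -
  have "\<forall>\<delta>\<subseteq>{..<K}. \<exists>p. \<exists>r::nat\<Rightarrow>nat. strict_mono r \<and>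
      (\<forall>\<epsilon>>0. \<forall>\<^sub>F n in sequentially. \<forall>i\<in>\<delta>. dist (X (r n) i) (p i) < \<epsilon>)"
  proof (rule compact_lemma_general[where proj = "\<lambda>x i. x i" and unproj = "\<lambda>x. x"])
    show "bounded ((\<lambda>x. x i) ` range X)" if "i \<in> {..<K}" for i
      using assms that by (auto simp: bounded_iff)
  qed auto
  then obtain p and r :: "nat \<Rightarrow> nat" where r: "strict_mono r"
    and p: "\<And>\<epsilon>. \<epsilon> > 0 \<Longrightarrow> \<forall>\<^sub>F n in sequentially. \<forall>i\<in>{..<K}. dist (X (r n) i) (p i) < \<epsilon>"
    by blast
  show thesis
  proof
    show "(\<lambda>n. X (r n) i) \<longlonglongrightarrow> (\<lambda>i. if i < K then p i else 0) i" if "i < K" for i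
      using that by (auto intro!: tendstoI elim!: eventually_mono[OF p])
  qed (auto simp: r Rspace_iff)
qed

lemma positive_lower_bound:
  fixes x :: rvec
  assumes "\<And>i. i < K \<Longrightarrow> 0 < x i"
  obtains r where "0 < r" "\<And>i. i < K \<Longrightarrow> r < x i"
proof -
  define m where "m = Min (insert 1 (x ` {..<K}))"
  have "0 < m" unfolding m_def using assms by (subst Min_gr_iff) auto
  moreover have "m \<le> x i" if "i < K" for i unfolding m_def using that by (intro Min_le) auto
  ultimately show thesis by (intro that[of "m / 2"]) force+
qed

lemma ext_finite_iff: "\<bar>ext A f x\<bar> \<noteq> \<infinity> \<longleftrightarrow> x \<in> A"
  by (simp add: ext_def)

lemma has_gradient_extD:
  assumes "has_gradient K (ext A f) g x"
  shows "x \<in> A"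
    and "0 < \<epsilon> \<Longrightarrow> \<exists>\<delta>>0. \<forall>h\<in>Rspace K. norm2 K h < \<delta> \<longrightarrow> (\<lambda>i. x i + h i) \<in> A \<and>
      \<bar>f (\<lambda>i. x i + h i) - f x - inner_prod K g h\<bar> \<le> \<epsilon> * norm2 K h"
proof -
  show x: "x \<in> A" using assms by (simp add: has_gradient_def ext_finite_iff)
  assume "0 < \<epsilon>"
  then obtain \<delta> where "\<delta> > 0" and \<delta>: "\<forall>h\<in>Rspace K. norm2 K h < \<delta> \<longrightarrow>
      (\<lambda>i. x i + h i) \<in> A \<and>
      \<bar>real_of_ereal (ext A f (\<lambda>i. x i + h i)) - real_of_ereal (ext A f x) - inner_prod K g h\<bar>
        \<le> \<epsilon> * norm2 K h"
    using assms unfolding has_gradient_def ext_finite_iff by blast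
  then show "\<exists>\<delta>>0. \<forall>h\<in>Rspace K. norm2 K h < \<delta> \<longrightarrow> (\<lambda>i. x i + h i) \<in> A \<and>
      \<bar>f (\<lambda>i. x i + h i) - f x - inner_prod K g h\<bar> \<le> \<epsilon> * norm2 K h"
    using x by (intro exI[of _ \<delta>]) (auto simp: ext_def)
qed

lemma has_gradient_unique:
  assumes "has_gradient K F g x" "has_gradient K F g' x"
  shows "g = g'"
proof -
  define v where "v = (\<lambda>i. g i - g' i)"
  have v: "v \<in> Rspace K" using assms by (simp add: v_def has_gradient_def Rspace_iff)
  have "norm2 K v \<le> 2 * \<epsilon>" if \<epsilon>: "\<epsilon> > 0" for \<epsilon>
  proof -
    let ?E = "\<lambda>g h. \<bar>real_of_ereal (F (\<lambda>i. x i + h i)) - real_of_ereal (F x) - inner_prod K g h\<bar>"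
    obtain \<delta> where \<delta>: "\<delta> > 0" "\<forall>h\<in>Rspace K. norm2 K h < \<delta> \<longrightarrow> ?E g h \<le> \<epsilon> * norm2 K h"
      using assms(1) \<epsilon> unfolding has_gradient_def by blast
    obtain \<delta>' where \<delta>': "\<delta>' > 0" "\<forall>h\<in>Rspace K. norm2 K h < \<delta>' \<longrightarrow> ?E g' h \<le> \<epsilon> * norm2 K h"
      using assms(2) \<epsilon> unfolding has_gradient_def by blast
    \<comment> \<open>The multiple \<open>s\<close> of \<open>v\<close> lies in the range of both
      first-order expansions; the \<open>+ 1\<close> keeps the quotient meaningful when
      \<open>v\<close> is zero.\<close>
    define s where "s = min \<delta> \<delta>' / (norm2 K v + 1)"
    have s: "0 < s"
      unfolding s_def using \<delta>(1) \<delta>'(1) by (intro divide_pos_pos add_nonneg_pos) auto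
    define h where "h = (\<lambda>i. s * v i)"
    have "s * norm2 K v < s * (norm2 K v + 1)" using s by simp
    also have "\<dots> = min \<delta> \<delta>'"
      unfolding s_def using norm2_nonneg[of K v] by (simp add: add_nonneg_eq_0_iff)
    finally have h: "norm2 K h < \<delta>" "norm2 K h < \<delta>'" "h \<in> Rspace K"
      using s v by (auto simp: h_def norm2_scale Rspace_iff)
    then have "\<bar>inner_prod K g h - inner_prod K g' h\<bar> \<le> 2 * (\<epsilon> * norm2 K h)"
      using \<delta>(2)[rule_format, OF h(3,1)] \<delta>'(2)[rule_format, OF h(3,2)] by linarith
    moreover have "inner_prod K g h - inner_prod K g' h = inner_prod K v h"
      by (simp add: v_def inner_prod_left(2))
    moreover have "inner_prod K v h = s * (norm2 K v * norm2 K v)"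
      using norm2_power2[of K v] by (simp add: h_def inner_prod_right(3) power2_eq_square)
    moreover have "norm2 K h = s * norm2 K v" using s by (simp add: h_def norm2_scale)
    ultimately have "s * (norm2 K v * norm2 K v) \<le> s * (norm2 K v * (2 * \<epsilon>))"
      by (simp add: mult.left_commute mult.commute abs_le_iff)
    then have "norm2 K v * norm2 K v \<le> norm2 K v * (2 * \<epsilon>)" using s by (rule mult_left_le_imp_le)
    then show ?thesis using norm2_nonneg[of K v] \<epsilon> by (cases "norm2 K v = 0") auto
  qed
  \<comment> \<open>For this choice of \<open>\<epsilon>\<close> the estimate says that the norm is
    at most half of itself.\<close>
  from this[of "norm2 K v / 4"] have "norm2 K v = 0"
    using norm2_nonneg[of K v] by (cases "norm2 K v = 0") auto
  then show ?thesis using norm2_eq_0D[OF _ v] by (auto simp: v_def)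
qed

lemma grad_eqI: "has_gradient K F g x \<Longrightarrow> grad K F x = g"
  unfolding grad_def by (blast intro: has_gradient_unique)

lemma has_gradient_tendsto:
  assumes "has_gradient K (ext A f) g x"
    and "\<And>n. X n \<in> Rspace K" "\<And>i. i < K \<Longrightarrow> (\<lambda>n. X n i) \<longlonglongrightarrow> x i"
  shows "(\<lambda>n. f (X n)) \<longlonglongrightarrow> f x"
proof -
  obtain \<delta> where \<delta>: "\<delta> > 0" "\<forall>h\<in>Rspace K. norm2 K h < \<delta> \<longrightarrow>
      \<bar>f (\<lambda>i. x i + h i) - f x - inner_prod K g h\<bar> \<le> 1 * norm2 K h"
    using has_gradient_extD(2)[OF assms(1) zero_less_one] by blast
  define H where "H n = (\<lambda>i. X n i - x i)" for n
  have "(\<lambda>n. norm2 K (H n)) \<longlonglongrightarrow> norm2 K (\<lambda>i. x i - x i)"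
    unfolding H_def using assms(3) by (intro tendsto_norm2 tendsto_intros)
  moreover have "norm2 K (\<lambda>i. x i - x i) = 0" by (simp add: norm2_def L2_set_def)
  ultimately have lim: "(\<lambda>n. norm2 K (H n)) \<longlonglongrightarrow> 0" by simp
  have H: "H n \<in> Rspace K" for n
    using assms(1,2) by (simp add: H_def has_gradient_def Rspace_iff)
  have "\<forall>\<^sub>F n in sequentially. norm2 K (H n) < \<delta>"
    using order_tendstoD(2)[OF lim \<delta>(1)] .
  then have "\<forall>\<^sub>F n in sequentially. norm (f (X n) - f x) \<le> (1 + norm2 K g) * norm2 K (H n)"
  proof eventually_elim
    case (elim n)
    have "\<bar>f (X n) - f x - inner_prod K g (H n)\<bar> \<le> norm2 K (H n)"
      using \<delta>(2)[rule_format, OF H elim] by (simp add: H_def)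
    then show ?case
      using inner_prod_le_norm2[of K g "H n"] unfolding distrib_right real_norm_def by linarith
  qed
  moreover have "(\<lambda>n. (1 + norm2 K g) * norm2 K (H n)) \<longlonglongrightarrow> 0"
    using tendsto_mult_left[OF lim, of "1 + norm2 K g"] by simp
  ultimately have "(\<lambda>n. f (X n) - f x) \<longlonglongrightarrow> 0" by (rule Lim_null_comparison)
  then show ?thesis by (simp add: LIM_zero_iff)
qed

lemma has_gradient_directional:
  assumes "has_gradient K (ext A f) g x" "v \<in> Rspace K"
  shows "((\<lambda>u. (f (\<lambda>i. x i + u * v i) - f x) / u) \<longlongrightarrow> inner_prod K g v) (at_right 0)"
proof (rule tendstoI)
  fix e :: real assume e: "0 < e"
  define n where "n = norm2 K v + 1"
  have n: "0 < n" "norm2 K v < n" unfolding n_def by (auto intro: add_nonneg_pos)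
  obtain \<delta> where \<delta>: "\<delta> > 0" "\<forall>h\<in>Rspace K. norm2 K h < \<delta> \<longrightarrow>
      \<bar>f (\<lambda>i. x i + h i) - f x - inner_prod K g h\<bar> \<le> e / n * norm2 K h"
    using has_gradient_extD(2)[OF assms(1), of "e / n"] e n by auto
  have "\<forall>\<^sub>F u in at_right 0. 0 < u \<and> u < \<delta> / n"
    using \<delta>(1) n by (auto simp: eventually_at_right_field intro!: exI[of _ "\<delta> / n"])
  then show "\<forall>\<^sub>F u in at_right 0. dist ((f (\<lambda>i. x i + u * v i) - f x) / u) (inner_prod K g v) < e"
  proof eventually_elim
    case (elim u)
    define h where "h = (\<lambda>i. u * v i)"
    have h: "h \<in> Rspace K" "norm2 K h = u * norm2 K v"
      using assms(2) elim by (auto simp: h_def Rspace_iff norm2_scale)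
    have "u * norm2 K v \<le> u * n" using elim n by (intro mult_left_mono) auto
    also have "\<dots> < \<delta>" using elim n by (simp add: field_simps)
    finally have "\<bar>f (\<lambda>i. x i + h i) - f x - inner_prod K g h\<bar> \<le> e / n * (u * norm2 K v)"
      using \<delta>(2) h by auto
    also have "\<dots> < e / n * (u * n)"
      using elim n e by (intro mult_strict_left_mono) auto
    also have "\<dots> = e * u" using n by simp
    finally have "\<bar>f (\<lambda>i. x i + h i) - f x - u * inner_prod K g v\<bar> < e * u"
      by (simp add: h_def inner_prod_right)
    moreover have "(f (\<lambda>i. x i + h i) - f x) / u - inner_prod K g v =
        (f (\<lambda>i. x i + h i) - f x - u * inner_prod K g v) / u"
      using elim by (simp add: field_simps)
    ultimately show ?case
      using elim by (simp add: dist_real_def h_def divide_less_eq)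
  qed
qed

section \<open>Interior of the orthant and behaviour at its boundary\<close>

definition positive_orthant :: "nat \<Rightarrow> rvec set" where
  "positive_orthant K = {x \<in> Rspace K. \<forall>i<K. 0 < x i}"

lemma positive_orthantD:
  assumes "x \<in> positive_orthant K"
  shows "x \<in> Rspace K" "i < K \<Longrightarrow> 0 < x i" "x \<in> orthant K"
  using assms by (auto simp: positive_orthant_def orthant_def less_imp_le)

lemma orthantD:
  assumes "x \<in> orthant K"
  shows "x \<in> Rspace K" "i < K \<Longrightarrow> 0 \<le> x i"
  using assms by (auto simp: orthant_def)

lemma prob_simplexD:
  assumes "x \<in> prob_simplex K"
  shows "x \<in> orthant K" "x \<in> Rspace K" "(\<Sum>i<K. x i) = 1" "i < K \<Longrightarrow> x i \<le> 1"
proof -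
  show "x \<in> orthant K" "x \<in> Rspace K" "(\<Sum>i<K. x i) = 1"
    using assms by (auto simp: prob_simplex_def orthant_def)
  show "x i \<le> 1" if "i < K"
    using assms that member_le_sum[of i "{..<K}" x] by (auto simp: prob_simplex_def)
qed

lemma positive_segment:
  assumes "a \<in> positive_orthant K" "p \<in> orthant K" "0 < u" "u \<le> 1"
  shows "(\<lambda>i. u * a i + (1 - u) * p i) \<in> positive_orthant K"
  using assms by (auto simp: positive_orthant_def orthant_def Rspace_iff intro!: add_pos_nonneg)

lemma positive_orthant_subset_interior:
  "positive_orthant K \<subseteq> Euclidean_space K interior_of orthant K"
proof (rule interior_of_maximal)
  show "positive_orthant K \<subseteq> orthant K" by (auto dest: positive_orthantD)
  have "open (\<Inter>i\<in>{..<K}. {x::rvec. 0 < x i})"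
    by (intro open_INT ballI open_Collect_less continuous_intros) auto
  then have "openin (powertop_real UNIV) (\<Inter>i\<in>{..<K}. {x::rvec. 0 < x i})"
    unfolding euclidean_product_topology by (simp flip: open_openin)
  moreover have "positive_orthant K = (\<Inter>i\<in>{..<K}. {x. 0 < x i}) \<inter> {x. \<forall>i\<ge>K. x i = 0}"
    by (auto simp: positive_orthant_def Rspace_iff)
  ultimately show "openin (Euclidean_space K) (positive_orthant K)"
    unfolding Euclidean_space_def openin_subtopology by blast
qed

lemma limitin_Euclidean_space:
  assumes "\<And>n. X n \<in> Rspace K" "p \<in> Rspace K" "\<And>i. (\<lambda>n. X n i) \<longlonglongrightarrow> p i"
  shows "limitin (Euclidean_space K) X p sequentially"
  using assms unfolding Euclidean_space_def limitin_subtopology limitin_componentwise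
  by (auto simp: topspace_Euclidean_space)

locale legendre_orthant =
  fixes K :: nat and \<Psi> :: "rvec \<Rightarrow> real"
  assumes legendre: "legendre K (orthant K) \<Psi>"
begin

abbreviation G :: "rvec \<Rightarrow> rvec" where "G \<equiv> grad_Psi K \<Psi>"

lemma strictly_convex: "strictly_convex_on (orthant K) \<Psi>"
  using legendre by (simp add: legendre_def)

lemma convex:
  assumes "x \<in> orthant K" "y \<in> orthant K" "0 \<le> u" "u \<le> 1"
  shows "\<Psi> (\<lambda>i. u * x i + (1 - u) * y i) \<le> u * \<Psi> x + (1 - u) * \<Psi> y"
proof (cases "x = y \<or> u = 0 \<or> u = 1")
  case True
  then show ?thesis by (auto simp: algebra_simps)
next
  case False
  then show ?thesis
    using strictly_convex assms by (auto simp: strictly_convex_on_def intro!: less_imp_le)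
qed

lemma has_gradient:
  assumes "x \<in> positive_orthant K"
  shows "has_gradient K (ext (orthant K) \<Psi>) (G x) x"
proof -
  obtain g where "has_gradient K (ext (orthant K) \<Psi>) g x"
    using legendre assms positive_orthant_subset_interior unfolding legendre_def Let_def by blast
  then show ?thesis unfolding grad_Psi_def using grad_eqI by metis
qed

lemma gradient_Rspace: "x \<in> positive_orthant K \<Longrightarrow> G x \<in> Rspace K"
  using has_gradient by (simp add: has_gradient_def)

text \<open>A gradient requires finite values on a whole neighbourhood, so a small step against each
  axis must stay in the orthant.\<close>

lemma has_gradient_imp_positive:
  assumes "has_gradient K (ext (orthant K) \<Psi>) g x"
  shows "x \<in> positive_orthant K"
proof -
  obtain \<delta> where \<delta>: "\<delta> > 0"
      "\<forall>h\<in>Rspace K. norm2 K h < \<delta> \<longrightarrow> (\<lambda>i. x i + h i) \<in> orthant K"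
    using has_gradient_extD(2)[OF assms zero_less_one] by blast
  have "0 < x i" if i: "i < K" for i
  proof -
    define h where "h = (\<lambda>j. if j = i then - \<delta> / 2 else 0)"
    have "norm2 K h \<le> (\<Sum>j<K. \<bar>h j\<bar>)" by (rule norm2_le_sum)
    also have "\<dots> = (\<Sum>j<K. if j = i then \<delta> / 2 else 0)"
      using \<delta>(1) by (intro sum.cong) (auto simp: h_def)
    also have "\<dots> < \<delta>" using i \<delta>(1) by simp
    finally have "(\<lambda>j. x j + h j) \<in> orthant K"
      using \<delta>(2) i by (auto simp: h_def Rspace_iff)
    then have "0 \<le> x i + h i" using i by (auto simp: orthant_def)
    then show ?thesis using \<delta>(1) by (simp add: h_def)
  qed
  then show ?thesis using assms by (simp add: positive_orthant_def has_gradient_def)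
qed

text \<open>The inclusion from left to right needs no topology: a Legendre function has a gradient
  at every interior point, and a gradient forces positive coordinates.\<close>

lemma interior_eq: "Euclidean_space K interior_of orthant K = positive_orthant K"
  using legendre positive_orthant_subset_interior has_gradient_imp_positive
  unfolding legendre_def Let_def by blast

text \<open>Convexity bounds the difference quotients towards \<open>y\<close> by
  \<open>\<Psi> y - \<Psi> x\<close>, and differentiability at \<open>x\<close> gives their limit.
  The point \<open>y\<close> may lie on the boundary.\<close>

lemma subgradient:
  assumes "x \<in> positive_orthant K" "y \<in> orthant K"
  shows "\<Psi> x + inner_prod K (G x) (\<lambda>i. y i - x i) \<le> \<Psi> y"
proof -
  have "(\<lambda>i. y i - x i) \<in> Rspace K"
    using assms by (simp add: positive_orthant_def orthant_def Rspace_iff)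
  then have "((\<lambda>u. (\<Psi> (\<lambda>i. x i + u * (y i - x i)) - \<Psi> x) / u) \<longlongrightarrow>
      inner_prod K (G x) (\<lambda>i. y i - x i)) (at_right 0)"
    by (intro has_gradient_directional[OF has_gradient[OF assms(1)]])
  moreover have "\<forall>\<^sub>F u in at_right 0. (\<Psi> (\<lambda>i. x i + u * (y i - x i)) - \<Psi> x) / u \<le> \<Psi> y - \<Psi> x"
  proof -
    have "\<forall>\<^sub>F u in at_right 0. (0::real) < u \<and> u < 1"
      by (auto simp: eventually_at_right_field intro!: exI[of _ 1])
    then show ?thesis
    proof eventually_elim
      case (elim u)
      have "(\<lambda>i. x i + u * (y i - x i)) = (\<lambda>i. u * y i + (1 - u) * x i)"
        by (auto simp: algebra_simps)
      then have "\<Psi> (\<lambda>i. x i + u * (y i - x i)) - \<Psi> x \<le> (\<Psi> y - \<Psi> x) * u"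
        using convex[of y x u] assms elim positive_orthantD(3) by (simp add: algebra_simps)
      then show ?case using elim by (simp add: divide_le_eq)
    qed
  qed
  ultimately have "inner_prod K (G x) (\<lambda>i. y i - x i) \<le> \<Psi> y - \<Psi> x"
    by (rule tendsto_upperbound) simp
  then show ?thesis by simp
qed

lemma bregman_nonneg:
  "x \<in> positive_orthant K \<Longrightarrow> y \<in> orthant K \<Longrightarrow> 0 \<le> bregman K \<Psi> y x"
  using subgradient[of x y] by (simp add: bregman_def)

lemma tendsto_Psi:
  assumes "x \<in> positive_orthant K"
    and "\<And>n. X n \<in> Rspace K" "\<And>i. i < K \<Longrightarrow> (\<lambda>n. X n i) \<longlonglongrightarrow> x i"
  shows "(\<lambda>n. \<Psi> (X n)) \<longlonglongrightarrow> \<Psi> x"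
  by (rule has_gradient_tendsto[OF has_gradient[OF assms(1)] assms(2,3)])

text \<open>A ball around \<open>a\<close> fits into the orthant, so the subgradient inequality at \<open>x\<close> bounds
  \<open>\<parallel>\<nabla>\<Psi>(x)\<parallel>\<close> in terms of \<open>\<langle>\<nabla>\<Psi>(x), a - x\<rangle>\<close>. As the norm blows up along the segment from \<open>a\<close> to the
  boundary point \<open>p\<close>, so does the slope.\<close>

lemma slope_unbounded_at_boundary:
  assumes a: "a \<in> positive_orthant K" and p: "p \<in> orthant K" "p \<notin> positive_orthant K"
  obtains u where "0 < u" "u < 1"
    "inner_prod K (G (\<lambda>i. u * a i + (1 - u) * p i)) (\<lambda>i. a i - p i) < Y"
proof -
  let ?x = "\<lambda>u i. u * a i + (1 - u) * p i"
  have False if slope: "\<And>u. 0 < u \<Longrightarrow> u < 1 \<Longrightarrow>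
      Y \<le> inner_prod K (G (?x u)) (\<lambda>i. a i - p i)"
  proof -
    obtain r where r: "0 < r" "\<And>i. i < K \<Longrightarrow> r < a i"
      using positive_lower_bound positive_orthantD(2)[OF a] by metis
    define b where "b c i = (\<lambda>j. a j + (if j = i then c else 0))" for c :: real and i
    have b: "b c i \<in> orthant K" if "i < K" "\<bar>c\<bar> \<le> r" for c i
      using that r positive_orthantD[OF a] by (force simp: b_def orthant_def Rspace_iff)
    \<comment> \<open>In place of the whole ball, the \<open>2 * K\<close> points at distance
      \<open>r\<close> from \<open>a\<close> along the axes suffice, and \<open>M\<close> bounds
      \<open>\<Psi>\<close> on them.\<close>
    define M where "M = (\<Sum>i<K. \<bar>\<Psi> (b r i)\<bar> + \<bar>\<Psi> (b (- r) i)\<bar>)"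
    have M: "\<Psi> (b r i) \<le> M" "\<Psi> (b (- r) i) \<le> M" if "i < K" for i
    proof -
      have "\<bar>\<Psi> (b r i)\<bar> + \<bar>\<Psi> (b (- r) i)\<bar> \<le> M"
        unfolding M_def using that by (intro member_le_sum) auto
      then show "\<Psi> (b r i) \<le> M" "\<Psi> (b (- r) i) \<le> M" by linarith+
    qed
    \<comment> \<open>A lower bound for \<open>\<Psi>\<close> on the whole segment, obtained from
      the gradient at \<open>a\<close>.\<close>
    define m where "m = \<Psi> a - \<bar>inner_prod K (G a) (\<lambda>i. p i - a i)\<bar>"
    define Q where "Q = M - m + \<bar>Y\<bar>"
    have bound: "norm2 K (G (?x u)) \<le> real K * (Q / r)" if u: "0 < u" "u < 1" for u
    proof -
      have pos: "?x u \<in> positive_orthant K" using a p u by (intro positive_segment) auto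
      have "(\<lambda>i. ?x u i - a i) = (\<lambda>i. (1 - u) * (p i - a i))" by (auto simp: algebra_simps)
      then have "\<Psi> a + (1 - u) * inner_prod K (G a) (\<lambda>i. p i - a i) \<le> \<Psi> (?x u)"
        using subgradient[OF a positive_orthantD(3)[OF pos]] by (simp add: inner_prod_right(3))
      moreover have "\<bar>(1 - u) * inner_prod K (G a) (\<lambda>i. p i - a i)\<bar> \<le>
          \<bar>inner_prod K (G a) (\<lambda>i. p i - a i)\<bar>"
        using u by (simp add: abs_mult mult_left_le_one_le)
      ultimately have m: "m \<le> \<Psi> (?x u)" unfolding m_def by linarith
      have "(1 - u) * Y \<le> (1 - u) * inner_prod K (G (?x u)) (\<lambda>i. a i - p i)"
        using slope[OF u] u by (intro mult_left_mono) auto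
      moreover have "\<bar>(1 - u) * Y\<bar> \<le> \<bar>Y\<bar>" using u by (simp add: abs_mult mult_left_le_one_le)
      ultimately have Y: "- \<bar>Y\<bar> \<le> (1 - u) * inner_prod K (G (?x u)) (\<lambda>i. a i - p i)"
        by linarith
      have step: "G (?x u) i * c \<le> Q" if i: "i < K" and c: "c = r \<or> c = - r" for i c
      proof -
        have abs_c: "\<bar>c\<bar> \<le> r" using c r(1) by auto
        have "(\<lambda>j. b c i j - ?x u j) =
            (\<lambda>j. (1 - u) * (a j - p j) + (if j = i then c else 0))"
          by (auto simp: b_def algebra_simps)
        then have "\<Psi> (?x u) + ((1 - u) * inner_prod K (G (?x u)) (\<lambda>i. a i - p i) + G (?x u) i * c)
            \<le> \<Psi> (b c i)"
          using subgradient[OF pos b[OF i abs_c]]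
          by (simp add: inner_prod_right(1,3) inner_prod_single[OF i])
        moreover have "\<Psi> (b c i) \<le> M" using M[OF i] c by auto
        ultimately show ?thesis using m Y unfolding Q_def by linarith
      qed
      have "\<bar>G (?x u) i\<bar> \<le> Q / r" if "i < K" for i
        using step[OF that, of r] step[OF that, of "- r"] r(1)
        by (simp add: abs_le_iff pos_le_divide_eq)
      then have "(\<Sum>i<K. \<bar>G (?x u) i\<bar>) \<le> (\<Sum>i<K. Q / r)" by (intro sum_mono) auto
      then show ?thesis using norm2_le_sum[of K "G (?x u)"] by simp
    qed
    \<comment> \<open>The shift by 2 keeps the weight strictly below 1, as \<open>bound\<close>
      requires.\<close>
    define X where "X n = ?x (1 / real (n + 2))" for n
    have X: "X n \<in> positive_orthant K" for n
      unfolding X_def using a p by (intro positive_segment) auto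
    have "(\<lambda>n. 1 / real (n + 2)) \<longlonglongrightarrow> 0"
      using LIMSEQ_ignore_initial_segment[OF lim_1_over_n, of 2] by simp
    then have "(\<lambda>n. X n i) \<longlonglongrightarrow> 0 * a i + (1 - 0) * p i" for i
      unfolding X_def by (intro tendsto_intros)
    then have lim: "limitin (Euclidean_space K) X p sequentially"
      using X p(1) by (intro limitin_Euclidean_space) (auto dest: positive_orthantD orthantD)
    have "p \<in> Euclidean_space K closure_of positive_orthant K"
      unfolding in_closure_of
    proof (intro conjI allI impI)
      show "p \<in> Rspace K" using p(1) by (rule orthantD)
      fix T assume T: "p \<in> T \<and> openin (Euclidean_space K) T"
      then have "\<forall>\<^sub>F n in sequentially. X n \<in> T" using lim by (simp add: limitin_def)
      then show "\<exists>y. y \<in> positive_orthant K \<and> y \<in> T"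
        using X by (auto simp: eventually_sequentially)
    qed
    moreover have "p \<notin> Euclidean_space K interior_of positive_orthant K"
      using p(2) interior_of_subset[of "Euclidean_space K" "positive_orthant K"] by blast
    ultimately have "p \<in> Euclidean_space K frontier_of positive_orthant K"
      by (simp add: frontier_of_def)
    then have "filterlim (\<lambda>n. norm2 K (G (X n))) at_top sequentially"
      using legendre lim X unfolding legendre_def Let_def interior_eq grad_Psi_def by blast
    then have "\<forall>\<^sub>F n in sequentially. real K * (Q / r) < norm2 K (G (X n))"
      by (simp add: filterlim_at_top_dense)
    then obtain n where "real K * (Q / r) < norm2 K (G (X n))"
      by (auto simp: eventually_sequentially)
    then show False using bound[of "1 / real (n + 2)"] by (simp add: X_def)
  qed
  then show thesis using that by (meson not_le)
qed

end

section \<open>Minimizing a tilted Legendre function over a closed convex set\<close>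

locale legendre_restricted = legendre_orthant +
  fixes S :: "rvec set"
  assumes S_orthant: "S \<subseteq> orthant K"
    and S_convex: "convex_domain K S"
    and S_closed: "\<And>X p. \<lbrakk>\<And>n. X n \<in> S; p \<in> Rspace K; \<And>i. i < K \<Longrightarrow> (\<lambda>n. X n i) \<longlonglongrightarrow> p i\<rbrakk> \<Longrightarrow> p \<in> S"
begin

text \<open>Its minimizers on \<open>S\<close> are the points at which the supremum defining the
  conjugate at \<open>y\<close> is attained.\<close>

abbreviation tilted :: "rvec \<Rightarrow> rvec \<Rightarrow> real" where
  "tilted y x \<equiv> \<Psi> x - inner_prod K y x"

lemma S_Rspace: "x \<in> S \<Longrightarrow> x \<in> Rspace K"
  using S_orthant by (auto simp: orthant_def)

lemma S_segment:
  "x \<in> S \<Longrightarrow> y \<in> S \<Longrightarrow> 0 \<le> u \<Longrightarrow> u \<le> 1 \<Longrightarrow> (\<lambda>i. u * x i + (1 - u) * y i) \<in> S"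
  using S_convex by (auto simp: convex_domain_def)

lemma tilted_convex:
  assumes "x \<in> S" "x' \<in> S" "0 \<le> u" "u \<le> 1"
  shows "tilted y (\<lambda>i. u * x i + (1 - u) * x' i) \<le> u * tilted y x + (1 - u) * tilted y x'"
  using convex[of x x' u] assms S_orthant by (auto simp: inner_prod_right algebra_simps)

lemma tendsto_tilted:
  assumes "x \<in> positive_orthant K" "\<And>n. X n \<in> S" "\<And>i. i < K \<Longrightarrow> (\<lambda>n. X n i) \<longlonglongrightarrow> x i"
  shows "(\<lambda>n. tilted y (X n)) \<longlonglongrightarrow> tilted y x"
  using assms S_Rspace by (intro tendsto_diff tendsto_Psi tendsto_inner_prod) auto

text \<open>The bound \<open>R\<close> is needed from above only, since \<open>S\<close> lies in the
  orthant. The positive point \<open>a\<close> plays two roles: its gradient gives an affine lower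
  bound, hence a finite infimum, and it is the interior end of the segments used below.\<close>

lemma tilted_minimizer_exists:
  assumes a: "a \<in> S" "a \<in> positive_orthant K"
    and R: "\<And>x i. x \<in> S \<Longrightarrow> tilted y x \<le> tilted y a \<Longrightarrow> i < K \<Longrightarrow> x i \<le> R"
  obtains z where "z \<in> S" "z \<in> positive_orthant K" "\<And>x. x \<in> S \<Longrightarrow> tilted y z \<le> tilted y x"
proof -
  define V where "V = tilted y ` {x \<in> S. tilted y x \<le> tilted y a}"
  define L where "L = Inf V"
  have box: "\<bar>x i\<bar> \<le> R" if "x \<in> S" "tilted y x \<le> tilted y a" "i < K" for x i
    using R[OF that] S_orthant that by (auto simp: orthant_def)
  have "bdd_below V"
    unfolding V_def
  proof (rule bdd_belowI2)
    fix x assume "x \<in> {x \<in> S. tilted y x \<le> tilted y a}"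
    then have x: "x \<in> S" "tilted y x \<le> tilted y a" by auto
    have "\<bar>inner_prod K (\<lambda>i. G a i - y i) x\<bar> \<le> (\<Sum>i<K. \<bar>G a i - y i\<bar> * R)"
      unfolding inner_prod_def using box[OF x]
      by (intro order_trans[OF sum_abs] sum_mono) (auto simp: abs_mult intro!: mult_left_mono)
    moreover have "\<Psi> a + inner_prod K (G a) (\<lambda>i. x i - a i) \<le> \<Psi> x"
      using subgradient[OF a(2)] x(1) S_orthant by blast
    ultimately show "\<Psi> a - inner_prod K (G a) a - (\<Sum>i<K. \<bar>G a i - y i\<bar> * R) \<le> tilted y x"
      unfolding inner_prod_left(2) inner_prod_right(2) by linarith
  qed
  have ne: "V \<noteq> {}" using a by (auto simp: V_def)
  have L: "L \<le> tilted y x" if "x \<in> S" for x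
  proof (cases "tilted y x \<le> tilted y a")
    case True
    then show ?thesis
      unfolding L_def using that \<open>bdd_below V\<close> by (intro cInf_lower) (auto simp: V_def)
  next
    case False
    have "L \<le> tilted y a"
      unfolding L_def using a \<open>bdd_below V\<close> by (intro cInf_lower) (auto simp: V_def)
    then show ?thesis using False by simp
  qed
  have "\<exists>x. x \<in> S \<and> tilted y x \<le> tilted y a \<and> tilted y x < L + 1 / real (Suc n)" for n
    using cInf_lessD[OF ne, of "L + 1 / real (Suc n)"] by (auto simp: L_def V_def)
  then obtain X where X: "\<And>n. X n \<in> S" "\<And>n. tilted y (X n) \<le> tilted y a"
      "\<And>n. tilted y (X n) < L + 1 / real (Suc n)"
    by metis
  obtain r p where r: "strict_mono r" and p: "p \<in> Rspace K"
      "\<And>i. i < K \<Longrightarrow> (\<lambda>n. X (r n) i) \<longlonglongrightarrow> p i"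
    by (rule bounded_sequence_convergent_subsequence[of K X R]) (use box X(1,2) in auto)
  have pS: "p \<in> S" using S_closed[of "\<lambda>n. X (r n)" p] X(1) p by auto
  have "(\<lambda>n. tilted y (X n)) \<longlonglongrightarrow> L"
  proof (rule tendsto_sandwich[where f = "\<lambda>_. L" and h = "\<lambda>n. L + 1 / real (Suc n)"])
    show "(\<lambda>n. L + 1 / real (Suc n)) \<longlonglongrightarrow> L"
      using tendsto_add[OF tendsto_const[of L] LIMSEQ_Suc[OF lim_1_over_n]] by simp
    show "\<forall>\<^sub>F n in sequentially. tilted y (X n) \<le> L + 1 / real (Suc n)"
      using X(3) by (intro always_eventually allI less_imp_le) auto
  qed (use X(1) L in \<open>simp_all\<close>)
  then have lim: "(\<lambda>n. tilted y (X (r n))) \<longlonglongrightarrow> L"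
    using LIMSEQ_subseq_LIMSEQ[of "\<lambda>n. tilted y (X n)" L r] r by (simp add: o_def)
  \<comment> \<open>Continuity of \<open>\<Psi>\<close> is available at positive points only. For
    \<open>u > 0\<close> the segment points are positive, so the limit can be taken there, and the
    value of \<open>\<Psi>\<close> at \<open>p\<close> itself never enters.\<close>
  have seg: "tilted y (\<lambda>i. u * a i + (1 - u) * p i) \<le> u * tilted y a + (1 - u) * L"
    if u: "0 < u" "u \<le> 1" for u
  proof (rule LIMSEQ_le)
    show "(\<lambda>n. tilted y (\<lambda>i. u * a i + (1 - u) * X (r n) i)) \<longlonglongrightarrow>
        tilted y (\<lambda>i. u * a i + (1 - u) * p i)"
    proof (rule tendsto_tilted)
      show "(\<lambda>i. u * a i + (1 - u) * p i) \<in> positive_orthant K"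
        using a(2) pS S_orthant u by (intro positive_segment) auto
      show "(\<lambda>i. u * a i + (1 - u) * X (r n) i) \<in> S" for n
        using a(1) X(1) u by (intro S_segment) auto
    qed (intro tendsto_intros p)
    show "(\<lambda>n. u * tilted y a + (1 - u) * tilted y (X (r n))) \<longlonglongrightarrow> u * tilted y a + (1 - u) * L"
      by (intro tendsto_intros lim)
    show "\<exists>N. \<forall>n\<ge>N. tilted y (\<lambda>i. u * a i + (1 - u) * X (r n) i) \<le>
        u * tilted y a + (1 - u) * tilted y (X (r n))"
      using a(1) X(1) u by (intro exI allI impI tilted_convex) auto
  qed
  have "p \<in> positive_orthant K"
  proof (rule ccontr)
    assume bd: "p \<notin> positive_orthant K"
    define x where "x u = (\<lambda>i. u * a i + (1 - u) * p i)" for u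
    obtain u where u: "0 < u" "u < 1"
      and slope: "inner_prod K (G (x u)) (\<lambda>i. a i - p i) < inner_prod K y (\<lambda>i. a i - p i)"
      unfolding x_def using slope_unbounded_at_boundary[OF a(2) _ bd] pS S_orthant by blast
    define c where "c = inner_prod K y (\<lambda>i. a i - p i) - inner_prod K (G (x u)) (\<lambda>i. a i - p i)"
    have c: "0 < c" using slope by (simp add: c_def)
    define Q where "Q = tilted y a - L + c"
    have Q: "0 < Q" using L[OF a(1)] c by (simp add: Q_def)
    have xu: "x w \<in> positive_orthant K" "x w \<in> S" if "0 < w" "w \<le> 1" for w
      unfolding x_def using a pS S_orthant that
      by (auto intro!: positive_segment S_segment)
    \<comment> \<open>From \<open>x u\<close> to \<open>x w\<close>, closer to \<open>p\<close>, the
      tilted function rises by at least \<open>(u - w) * c\<close> above a value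
      \<open>\<ge> L\<close>, whereas \<open>seg\<close> permits at most
      \<open>w * (tilted y a - L)\<close> above \<open>L\<close>. This forces
      \<open>u * c \<le> w * Q\<close>, which the second argument of \<open>min\<close> violates;
      the first ensures \<open>w < u\<close>.\<close>
    define w where "w = min (u / 2) (u * c / (2 * Q))"
    have w: "0 < w" "w < u" "w \<le> 1" using u c Q by (auto simp: w_def)
    have "(\<lambda>i. x w i - x u i) = (\<lambda>i. (w - u) * (a i - p i))"
      by (auto simp: x_def algebra_simps)
    then have diff: "inner_prod K g (x w) - inner_prod K g (x u) =
        (w - u) * inner_prod K g (\<lambda>i. a i - p i)" for g
      using inner_prod_right(2,3)[of K g] by metis
    have "\<Psi> (x u) + (inner_prod K (G (x u)) (x w) - inner_prod K (G (x u)) (x u)) \<le> \<Psi> (x w)"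
      using subgradient[of "x u" "x w"] xu[of u] xu[of w] u w positive_orthantD(3)
      by (simp add: inner_prod_right)
    then have "tilted y (x u) + (u - w) * c \<le> tilted y (x w)"
      using diff[of "G (x u)"] diff[of y] by (simp add: c_def algebra_simps)
    moreover have "L \<le> tilted y (x u)" using L xu[of u] u by auto
    moreover have "tilted y (x w) \<le> w * tilted y a + (1 - w) * L"
      using seg[of w] w by (simp add: x_def)
    ultimately have "u * c \<le> w * Q" by (simp add: Q_def algebra_simps)
    moreover have "w * Q \<le> u * c / (2 * Q) * Q" using Q by (intro mult_right_mono) (auto simp: w_def)
    moreover have "0 < u * c" using u c by simp
    ultimately show False using Q by simp
  qed
  moreover from this have "tilted y p = L"
    using X(1) p(2) by (intro LIMSEQ_unique[OF tendsto_tilted lim]) auto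
  ultimately show thesis using that[of p] pS L by auto
qed

text \<open>The points of \<open>S\<close> at distance \<open>\<epsilon>\<close> from
  \<open>z\<close> are positive, so \<open>\<Psi>\<close> is continuous there, and compactness with
  strict convexity leaves a positive gap. Convexity carries the gap outwards in proportion to the
  distance.\<close>

lemma tilted_linear_growth:
  assumes z: "z \<in> S" "\<And>i. i < K \<Longrightarrow> \<epsilon> < z i" and \<epsilon>: "0 < \<epsilon>"
    and min: "\<And>x. x \<in> S \<Longrightarrow> tilted y z \<le> tilted y x"
  obtains \<delta> where "0 < \<delta>" "\<And>x. x \<in> S \<Longrightarrow> \<epsilon> \<le> norm2 K (\<lambda>i. x i - z i) \<Longrightarrow>
    \<delta> * norm2 K (\<lambda>i. x i - z i) \<le> tilted y x - tilted y z"
proof -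
  let ?d = "\<lambda>x. norm2 K (\<lambda>i. x i - z i)"
  have "\<exists>\<delta>>0. \<forall>x\<in>S. ?d x = \<epsilon> \<longrightarrow> \<delta> \<le> tilted y x - tilted y z"
  proof (rule ccontr)
    assume neg: "\<not> ?thesis"
    have "\<exists>x. x \<in> S \<and> ?d x = \<epsilon> \<and> tilted y x < tilted y z + 1 / real (Suc n)" for n
      using neg by (auto simp: not_le dest!: spec[of _ "1 / real (Suc n)"])
    then obtain X where X: "\<And>n. X n \<in> S" "\<And>n. ?d (X n) = \<epsilon>"
        "\<And>n. tilted y (X n) < tilted y z + 1 / real (Suc n)"
      by metis
    have Xb: "\<bar>X n i\<bar> \<le> norm2 K z + \<epsilon>" if "i < K" for n i
      using norm2_component_le[OF that, of "\<lambda>i. X n i - z i"] norm2_component_le[OF that, of z] X(2)[of n]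
      by linarith
    obtain r p where r: "strict_mono r" and p: "p \<in> Rspace K"
        "\<And>i. i < K \<Longrightarrow> (\<lambda>n. X (r n) i) \<longlonglongrightarrow> p i"
      by (rule bounded_sequence_convergent_subsequence[of K X "norm2 K z + \<epsilon>"]) (use Xb in auto)
    have pS: "p \<in> S" using S_closed[of "\<lambda>n. X (r n)" p] X(1) p by auto
    have "(\<lambda>n. ?d (X (r n))) \<longlonglongrightarrow> ?d p" by (intro tendsto_norm2 tendsto_intros p)
    then have dp: "?d p = \<epsilon>" by (simp add: X(2) LIMSEQ_const_iff)
    have "0 < p i" if "i < K" for i
      using norm2_component_le[OF that, of "\<lambda>i. p i - z i"] z(2)[OF that] dp by auto
    then have pos: "p \<in> positive_orthant K" using p(1) by (simp add: positive_orthant_def)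
    have "(\<lambda>n. tilted y (X (r n))) \<longlonglongrightarrow> tilted y p"
      using X(1) p(2) pos by (intro tendsto_tilted) auto
    moreover have "(\<lambda>n. tilted y z + 1 / real (Suc (r n))) \<longlonglongrightarrow> tilted y z + 0"
      using LIMSEQ_subseq_LIMSEQ[OF LIMSEQ_Suc[OF lim_1_over_n] r]
      by (intro tendsto_intros) (simp add: o_def)
    ultimately have le: "tilted y p \<le> tilted y z"
      using X(3) by (intro LIMSEQ_le[of _ _ _ "tilted y z"]) (auto intro!: less_imp_le)
    \<comment> \<open>A second point of minimal value would let the midpoint beat the
      minimum.\<close>
    have "p \<noteq> z" using dp \<epsilon> by (auto simp: norm2_def L2_set_def)
    moreover have "p \<in> orthant K" "z \<in> orthant K" using pS z(1) S_orthant by auto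
    ultimately have "\<Psi> (\<lambda>i. 1 / 2 * p i + (1 - 1 / 2) * z i) < 1 / 2 * \<Psi> p + (1 - 1 / 2) * \<Psi> z"
      using strictly_convex[unfolded strictly_convex_on_def, rule_format, of p z "1 / 2"] by simp
    moreover have "tilted y z \<le> tilted y (\<lambda>i. 1 / 2 * p i + (1 - 1 / 2) * z i)"
      using pS z(1) by (intro min S_segment) auto
    moreover have "inner_prod K y (\<lambda>i. 1 / 2 * p i + (1 - 1 / 2) * z i) =
        1 / 2 * inner_prod K y p + (1 - 1 / 2) * inner_prod K y z"
      by (simp only: inner_prod_right)
    ultimately show False using le by (simp add: field_simps)
  qed
  then obtain \<delta> where \<delta>: "0 < \<delta>" "\<And>x. x \<in> S \<Longrightarrow> ?d x = \<epsilon> \<Longrightarrow> \<delta> \<le> tilted y x - tilted y z"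
    by blast
  have "\<delta> / \<epsilon> * ?d x \<le> tilted y x - tilted y z" if x: "x \<in> S" "\<epsilon> \<le> ?d x" for x
  proof -
    \<comment> \<open>With this weight, \<open>?q\<close> is the point of the segment from
      \<open>z\<close> to \<open>x\<close> at distance \<open>\<epsilon>\<close> from
      \<open>z\<close>.\<close>
    define u where "u = \<epsilon> / ?d x"
    have u: "0 < u" "u \<le> 1" using x \<epsilon> by (auto simp: u_def)
    let ?q = "\<lambda>i. u * x i + (1 - u) * z i"
    have "(\<lambda>i. ?q i - z i) = (\<lambda>i. u * (x i - z i))" by (auto simp: algebra_simps)
    then have "?d ?q = u * ?d x" using u by (simp add: norm2_scale)
    also have "\<dots> = \<epsilon>" using x \<epsilon> by (simp add: u_def)
    finally have "\<delta> \<le> tilted y ?q - tilted y z" using u x z(1) by (intro \<delta>(2) S_segment) auto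
    also have "\<dots> \<le> u * (tilted y x - tilted y z)"
      using tilted_convex[OF x(1) z(1), of u y] u by (simp add: algebra_simps)
    finally show ?thesis using x(2) \<epsilon> by (simp add: u_def field_simps)
  qed
  then show thesis using \<delta>(1) \<epsilon> by (intro that[of "\<delta> / \<epsilon>"]) auto
qed

lemma fenchel_conj_bounds:
  assumes "z \<in> S" "\<And>x. x \<in> S \<Longrightarrow> inner_prod K y x - \<Psi> x \<le> U"
  shows "ereal (inner_prod K y z - \<Psi> z) \<le> fenchel_conj K (ext S \<Psi>) y"
    and "fenchel_conj K (ext S \<Psi>) y \<le> ereal U"
proof -
  have "ereal (inner_prod K y z - \<Psi> z) = ereal (inner_prod K y z) - ext S \<Psi> z"
    using assms(1) by (simp add: ext_def)
  also have "\<dots> \<le> fenchel_conj K (ext S \<Psi>) y"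
    unfolding fenchel_conj_def using assms(1) S_Rspace by (intro SUP_upper) auto
  finally show "ereal (inner_prod K y z - \<Psi> z) \<le> fenchel_conj K (ext S \<Psi>) y" .
  show "fenchel_conj K (ext S \<Psi>) y \<le> ereal U"
    unfolding fenchel_conj_def using assms(2) by (intro SUP_least) (auto simp: ext_def)
qed

text \<open>Inserting \<open>z\<close> into the supremum bounds the increment of the conjugate from
  below by the linear term. From above, points within \<open>\<epsilon>\<close> of \<open>z\<close>
  exceed it by at most \<open>e * norm2 K h\<close>, and for \<open>norm2 K h < \<delta>\<close>
  linear growth outweighs whatever farther points could gain.\<close>

lemma has_gradient_fenchel_conj:
  assumes y: "y \<in> Rspace K" and z: "z \<in> S" "z \<in> positive_orthant K"
    and min: "\<And>x. x \<in> S \<Longrightarrow> tilted y z \<le> tilted y x"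
  shows "has_gradient K (fenchel_conj K (ext S \<Psi>)) z y"
proof -
  let ?F = "fenchel_conj K (ext S \<Psi>)"
  define c where "c = inner_prod K y z - \<Psi> z"
  have "ereal c \<le> ?F y" "?F y \<le> ereal c"
  proof -
    have "inner_prod K y x - \<Psi> x \<le> c" if "x \<in> S" for x
      using min[OF that] by (simp add: c_def)
    from fenchel_conj_bounds[OF z(1) this] show "ereal c \<le> ?F y" "?F y \<le> ereal c"
      by (simp_all add: c_def)
  qed
  then have Fy: "?F y = ereal c" by (rule antisym[rotated])
  have "\<exists>\<delta>>0. \<forall>h\<in>Rspace K. norm2 K h < \<delta> \<longrightarrow> \<bar>?F (\<lambda>i. y i + h i)\<bar> \<noteq> \<infinity> \<and>
      \<bar>real_of_ereal (?F (\<lambda>i. y i + h i)) - real_of_ereal (?F y) - inner_prod K z h\<bar> \<le> e * norm2 K h"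
    if e: "0 < e" for e
  proof -
    obtain \<epsilon>0 where \<epsilon>0: "0 < \<epsilon>0" "\<And>i. i < K \<Longrightarrow> \<epsilon>0 < z i"
      using positive_lower_bound positive_orthantD(2)[OF z(2)] by metis
    \<comment> \<open>One radius for two purposes: at most \<open>e\<close> for the error term,
      below every coordinate of \<open>z\<close> for the growth lemma.\<close>
    define \<epsilon> where "\<epsilon> = min e \<epsilon>0"
    have \<epsilon>: "0 < \<epsilon>" "\<epsilon> \<le> e" "\<And>i. i < K \<Longrightarrow> \<epsilon> < z i"
      using e \<epsilon>0 by (auto simp: \<epsilon>_def min_less_iff_disj)
    obtain \<delta> where \<delta>: "0 < \<delta>" "\<And>x. x \<in> S \<Longrightarrow> \<epsilon> \<le> norm2 K (\<lambda>i. x i - z i) \<Longrightarrow>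
        \<delta> * norm2 K (\<lambda>i. x i - z i) \<le> tilted y x - tilted y z"
      using tilted_linear_growth[OF z(1) \<epsilon>(3,1) min] by metis
    have "\<bar>?F (\<lambda>i. y i + h i)\<bar> \<noteq> \<infinity> \<and>
        \<bar>real_of_ereal (?F (\<lambda>i. y i + h i)) - real_of_ereal (?F y) - inner_prod K z h\<bar> \<le> e * norm2 K h"
      if h: "norm2 K h < \<delta>" for h
    proof -
      let ?U = "c + inner_prod K h z + e * norm2 K h"
      have upper: "inner_prod K (\<lambda>i. y i + h i) x - \<Psi> x \<le> ?U" if x: "x \<in> S" for x
      proof -
        let ?d = "norm2 K (\<lambda>i. x i - z i)"
        have cs: "inner_prod K h x - inner_prod K h z \<le> norm2 K h * ?d"
          using inner_prod_le_norm2[of K h "\<lambda>i. x i - z i"] by (simp add: inner_prod_right)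
        have "norm2 K h * ?d \<le> e * norm2 K h + (tilted y x - tilted y z)"
        proof (cases "\<epsilon> \<le> ?d")
          case True
          have "norm2 K h * ?d \<le> \<delta> * ?d" using h by (intro mult_right_mono) auto
          also have "\<dots> \<le> tilted y x - tilted y z" by (rule \<delta>(2)[OF x True])
          finally show ?thesis using e by (simp add: add_increasing)
        next
          case False
          then have "norm2 K h * ?d \<le> norm2 K h * e" using \<epsilon>(2) by (intro mult_left_mono) auto
          then show ?thesis using min[OF x] by (simp add: mult.commute)
        qed
        then show ?thesis using cs by (simp add: c_def inner_prod_left)
      qed
      have "ereal (c + inner_prod K h z) \<le> ?F (\<lambda>i. y i + h i)" "?F (\<lambda>i. y i + h i) \<le> ereal ?U"
        using fenchel_conj_bounds[OF z(1) upper] by (simp_all add: c_def inner_prod_left algebra_simps)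
      then show ?thesis
        unfolding Fy by (cases "?F (\<lambda>i. y i + h i)") (auto simp: inner_prod_commute[of K z])
    qed
    then show ?thesis by (intro exI[of _ \<delta>] conjI[OF \<delta>(1)] ballI impI)
  qed
  then show ?thesis using y z S_Rspace by (auto simp: has_gradient_def Fy)
qed

text \<open>First-order optimality: from the minimizer towards \<open>x\<close>, the difference
  quotients of \<open>\<Psi>\<close> dominate the slope of the linear tilt, and this survives in the
  limit.\<close>

lemma tilted_minimizer_variational:
  assumes z: "z \<in> S" "z \<in> positive_orthant K" and x: "x \<in> S"
    and min: "\<And>x. x \<in> S \<Longrightarrow> tilted y z \<le> tilted y x"
  shows "inner_prod K y (\<lambda>i. x i - z i) \<le> inner_prod K (G z) (\<lambda>i. x i - z i)"
proof -
  have "(\<lambda>i. x i - z i) \<in> Rspace K"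
    using S_Rspace[OF z(1)] S_Rspace[OF x] by (simp add: Rspace_iff)
  then have "((\<lambda>u. (\<Psi> (\<lambda>i. z i + u * (x i - z i)) - \<Psi> z) / u) \<longlongrightarrow>
      inner_prod K (G z) (\<lambda>i. x i - z i)) (at_right 0)"
    by (intro has_gradient_directional[OF has_gradient[OF z(2)]])
  moreover have "\<forall>\<^sub>F u in at_right 0.
      inner_prod K y (\<lambda>i. x i - z i) \<le> (\<Psi> (\<lambda>i. z i + u * (x i - z i)) - \<Psi> z) / u"
  proof -
    have "\<forall>\<^sub>F u in at_right 0. (0::real) < u \<and> u < 1"
      by (auto simp: eventually_at_right_field intro!: exI[of _ 1])
    then show ?thesis
    proof eventually_elim
      case (elim u)
      have eq: "(\<lambda>i. u * x i + (1 - u) * z i) = (\<lambda>i. z i + u * (x i - z i))"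
        by (auto simp: algebra_simps)
      have "tilted y z \<le> tilted y (\<lambda>i. z i + u * (x i - z i))"
        using S_segment[of x z u] x z(1) elim by (intro min) (simp add: eq)
      then have "inner_prod K y (\<lambda>i. x i - z i) * u \<le> \<Psi> (\<lambda>i. z i + u * (x i - z i)) - \<Psi> z"
        by (simp add: inner_prod_right(1,3) mult.commute)
      then show ?case using elim by (simp add: le_divide_eq)
    qed
  qed
  ultimately show ?thesis by (intro tendsto_lowerbound[of _ _ "at_right 0"]) auto
qed

end

section \<open>The conjugates on the simplex and on the orthant\<close>

lemma convex_domain_orthant: "convex_domain K (orthant K)"
  by (auto simp: convex_domain_def orthant_def Rspace_iff)

lemma convex_domain_prob_simplex: "convex_domain K (prob_simplex K)"
proof -
  have "(\<Sum>i<K. u * x i + (1 - u) * y i) = u * (\<Sum>i<K. x i) + (1 - u) * (\<Sum>i<K. y i)"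
    for u :: real and x y :: rvec
    unfolding sum.distrib sum_distrib_left ..
  then show ?thesis by (auto simp: convex_domain_def prob_simplex_def Rspace_iff)
qed

lemma orthant_closed:
  assumes "\<And>n. X n \<in> orthant K" "p \<in> Rspace K" "\<And>i. i < K \<Longrightarrow> (\<lambda>n. X n i) \<longlonglongrightarrow> p i"
  shows "p \<in> orthant K"
proof -
  have "0 \<le> p i" if i: "i < K" for i
    using assms(3)[OF i] orthantD(2)[OF assms(1) i] by (intro LIMSEQ_le_const[of _ "p i" 0]) auto
  then show ?thesis using assms(2) by (simp add: orthant_def)
qed

lemma prob_simplex_closed:
  assumes "\<And>n. X n \<in> prob_simplex K" "p \<in> Rspace K" "\<And>i. i < K \<Longrightarrow> (\<lambda>n. X n i) \<longlonglongrightarrow> p i"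
  shows "p \<in> prob_simplex K"
proof -
  have "p \<in> orthant K"
    by (rule orthant_closed[OF prob_simplexD(1)[OF assms(1)] assms(2,3)])
  moreover have "(\<lambda>n. \<Sum>i<K. X n i) \<longlonglongrightarrow> (\<Sum>i<K. p i)"
    using assms(3) by (intro tendsto_sum) auto
  then have "(\<Sum>i<K. p i) = 1"
    using assms(1) by (simp add: prob_simplexD(3) LIMSEQ_const_iff)
  ultimately show ?thesis by (simp add: prob_simplex_def orthant_def)
qed

lemma prob_simplex_vertex: "i < K \<Longrightarrow> (\<lambda>j. if j = i then 1 else 0) \<in> prob_simplex K"
  by (simp add: prob_simplex_def Rspace_iff)

context legendre_orthant
begin

interpretation simplex: legendre_restricted K \<Psi> "prob_simplex K"
proof
  show "prob_simplex K \<subseteq> orthant K" using prob_simplexD(1) by (rule subsetI)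
qed (rule convex_domain_prob_simplex, rule prob_simplex_closed)

interpretation orthant: legendre_restricted K \<Psi> "orthant K"
  by unfold_locales (rule order_refl, rule convex_domain_orthant, rule orthant_closed)

text \<open>The maximizer is positive, so one can move from it both towards and away from any point
  of the simplex, and the first-order inequality becomes an equality. The gradient at
  \<open>z\<close> recovers \<open>y\<close> only on differences of simplex points, which is all
  that divergences between such points need.\<close>

lemma grad_conj_bar:
  assumes a: "a \<in> prob_simplex K" "a \<in> positive_orthant K" and y: "y \<in> Rspace K"
  defines "z \<equiv> grad_conj_bar K \<Psi> y"
  shows "z \<in> prob_simplex K" "z \<in> positive_orthant K"
    and "u \<in> prob_simplex K \<Longrightarrow> v \<in> prob_simplex K \<Longrightarrow>
      inner_prod K y (\<lambda>i. u i - v i) = inner_prod K (G z) (\<lambda>i. u i - v i)"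
proof -
  obtain m where m: "m \<in> prob_simplex K" "m \<in> positive_orthant K"
    and min: "\<And>x. x \<in> prob_simplex K \<Longrightarrow> simplex.tilted y m \<le> simplex.tilted y x"
    using simplex.tilted_minimizer_exists[OF a, of y 1] prob_simplexD(4) by metis
  have zm: "z = m"
    unfolding z_def grad_conj_bar_def
    by (intro grad_eqI simplex.has_gradient_fenchel_conj y m min)
  show "z \<in> prob_simplex K" "z \<in> positive_orthant K" using m zm by auto
  have dir: "inner_prod K y (\<lambda>i. u i - m i) = inner_prod K (G m) (\<lambda>i. u i - m i)"
    if u: "u \<in> prob_simplex K" for u
  proof (rule antisym)
    show "inner_prod K y (\<lambda>i. u i - m i) \<le> inner_prod K (G m) (\<lambda>i. u i - m i)"
      by (intro simplex.tilted_minimizer_variational m min u)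
    obtain r where r: "0 < r" "\<And>i. i < K \<Longrightarrow> r < m i"
      using positive_lower_bound positive_orthantD(2)[OF m(2)] by metis
    \<comment> \<open>\<open>w\<close> lies opposite to \<open>u\<close> as seen from
      \<open>m\<close>. Since \<open>u i - m i\<close> is at most 1, a step length below all
      coordinates of \<open>m\<close> keeps it in the simplex.\<close>
    define w where "w = (\<lambda>i. m i - r * (u i - m i))"
    have "0 \<le> w i" if "i < K" for i
    proof -
      have "r * (u i - m i) \<le> r * 1"
        using prob_simplexD(4)[OF u that] positive_orthantD(2)[OF m(2) that] r(1)
        by (intro mult_left_mono) auto
      then show ?thesis using r(2)[OF that] by (simp add: w_def)
    qed
    moreover have "(\<Sum>i<K. w i) = 1"
      using u m(1) by (simp add: w_def sum_subtractf prob_simplex_def flip: sum_distrib_left)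
    ultimately have "w \<in> prob_simplex K"
      using u m(1) by (auto simp: prob_simplex_def Rspace_iff w_def)
    then have "inner_prod K y (\<lambda>i. w i - m i) \<le> inner_prod K (G m) (\<lambda>i. w i - m i)"
      by (intro simplex.tilted_minimizer_variational m min)
    moreover have "(\<lambda>i. w i - m i) = (\<lambda>i. (- r) * (u i - m i))" by (auto simp: w_def)
    ultimately show "inner_prod K (G m) (\<lambda>i. u i - m i) \<le> inner_prod K y (\<lambda>i. u i - m i)"
      using r(1) by (simp only: inner_prod_right(3)) simp
  qed
  show "inner_prod K y (\<lambda>i. u i - v i) = inner_prod K (G z) (\<lambda>i. u i - v i)"
    if "u \<in> prob_simplex K" "v \<in> prob_simplex K"
    using dir[OF that(1)] dir[OF that(2)] unfolding zm inner_prod_right(2) by linarith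
qed

text \<open>Growth of \<open>\<Psi> - \<langle>\<nabla>\<Psi>(x), \<cdot>\<rangle>\<close> away from its minimizer \<open>x\<close> keeps the sublevel sets bounded
  after the tilt by \<open>c \<ge> 0\<close>, so the supremum defining \<open>\<Psi>\<^sup>*\<close> is attained.\<close>

lemma grad_conj:
  assumes x: "x \<in> positive_orthant K" and c: "c \<in> orthant K"
  defines "y \<equiv> (\<lambda>i. G x i - c i)"
  defines "z \<equiv> grad_conj K \<Psi> y"
  shows "z \<in> positive_orthant K" "G z = y"
proof -
  have y: "y \<in> Rspace K"
    using gradient_Rspace[OF x] orthantD(1)[OF c] by (simp add: y_def Rspace_iff)
  obtain \<epsilon> where \<epsilon>: "0 < \<epsilon>" "\<And>i. i < K \<Longrightarrow> \<epsilon> < x i"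
    using positive_lower_bound positive_orthantD(2)[OF x] by metis
  have "orthant.tilted (G x) x \<le> orthant.tilted (G x) u" if "u \<in> orthant K" for u
    using subgradient[OF x that] by (simp add: inner_prod_right)
  then obtain \<delta> where \<delta>: "0 < \<delta>" "\<And>u. u \<in> orthant K \<Longrightarrow> \<epsilon> \<le> norm2 K (\<lambda>i. u i - x i) \<Longrightarrow>
      \<delta> * norm2 K (\<lambda>i. u i - x i) \<le> orthant.tilted (G x) u - orthant.tilted (G x) x"
    using orthant.tilted_linear_growth[OF positive_orthantD(3)[OF x] \<epsilon>(2,1), of "G x"] by blast
  define R where "R = norm2 K x + \<epsilon> + \<bar>inner_prod K c x\<bar> / \<delta>"
  have R: "u i \<le> R" if u: "u \<in> orthant K" "orthant.tilted y u \<le> orthant.tilted y x" and i: "i < K" for u i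
  proof -
    have "norm2 K (\<lambda>i. u i - x i) \<le> \<epsilon> + \<bar>inner_prod K c x\<bar> / \<delta>"
    proof (cases "\<epsilon> \<le> norm2 K (\<lambda>i. u i - x i)")
      case True
      have "0 \<le> inner_prod K c u"
        using u c unfolding inner_prod_def by (intro sum_nonneg mult_nonneg_nonneg) (auto dest: orthantD)
      then have "\<delta> * norm2 K (\<lambda>i. u i - x i) \<le> \<bar>inner_prod K c x\<bar>"
        using \<delta>(2)[OF u(1) True] u(2) unfolding y_def inner_prod_left(2) by linarith
      then have "norm2 K (\<lambda>i. u i - x i) \<le> \<bar>inner_prod K c x\<bar> / \<delta>"
        using \<delta>(1) by (simp add: field_simps)
      then show ?thesis using \<epsilon>(1) by linarith
    next
      case False
      have "0 \<le> \<bar>inner_prod K c x\<bar> / \<delta>" using \<delta>(1) by simp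
      then show ?thesis using False by linarith
    qed
    then show ?thesis
      using norm2_component_le[OF i, of "\<lambda>i. u i - x i"] norm2_component_le[OF i, of x]
      unfolding R_def by linarith
  qed
  obtain m where m: "m \<in> orthant K" "m \<in> positive_orthant K"
    and min: "\<And>u. u \<in> orthant K \<Longrightarrow> orthant.tilted y m \<le> orthant.tilted y u"
    by (rule orthant.tilted_minimizer_exists[OF positive_orthantD(3)[OF x] x], (rule R; assumption), blast)
  have zm: "z = m"
    unfolding z_def grad_conj_def
    by (intro grad_eqI orthant.has_gradient_fenchel_conj y m min)
  then show "z \<in> positive_orthant K" using m by simp
  obtain r where r: "0 < r" "\<And>i. i < K \<Longrightarrow> r < m i"
    using positive_lower_bound positive_orthantD(2)[OF m(2)] by metis
  \<comment> \<open>Steps of both signs along each axis are feasible here, so the gradient is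
    recovered completely.\<close>
  have step: "y i * s \<le> G m i * s" if "i < K" "\<bar>s\<bar> \<le> r" for i s
  proof -
    define w where "w = (\<lambda>j. m j + (if j = i then s else 0))"
    have "w \<in> orthant K"
      using that r(2)[of i] m(1) by (auto simp: w_def orthant_def Rspace_iff)
    then have "inner_prod K y (\<lambda>j. w j - m j) \<le> inner_prod K (G m) (\<lambda>j. w j - m j)"
      by (intro orthant.tilted_minimizer_variational m min)
    then show ?thesis by (simp add: w_def inner_prod_single[OF that(1)])
  qed
  have "G m i = y i" for i
  proof (cases "i < K")
    case True
    then show ?thesis using step[of i r] step[of i "- r"] r(1) by simp
  next
    case False
    then show ?thesis using y gradient_Rspace[OF m(2)] by (simp add: Rspace_iff)
  qed
  then show "G z = y" unfolding zm by auto
qed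

text \<open>The difference of the two divergences depends on \<open>z\<close> only through a term
  linear in \<open>G z\<close>, so it can be averaged over several points \<open>z\<close> when only
  the average of their gradients is known.\<close>

lemma bregman_three_point:
  "bregman K \<Psi> u z = bregman K \<Psi> x z + \<Psi> u - \<Psi> x - inner_prod K (G z) (\<lambda>i. u i - x i)"
  by (simp add: bregman_def inner_prod_right)

end

section \<open>Regret\<close>

locale banker_run = banker_bookkeeping T d ord \<sigma> + legendre_orthant K \<Psi>
  for T d ord \<sigma> K \<Psi> +
  fixes x0 :: rvec and l :: "nat \<Rightarrow> rvec"
  assumes losses: "bandit_losses K T l"
    and x0_simplex: "x0 \<in> prob_simplex K" and x0_positive: "x0 \<in> positive_orthant K"
begin

abbreviation action :: "(nat \<Rightarrow> nat) \<Rightarrow> nat \<Rightarrow> rvec" where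
  "action \<omega> t \<equiv> banker_x K \<Psi> x0 l \<sigma> ord \<omega> t"

abbreviation estimate :: "(nat \<Rightarrow> nat) \<Rightarrow> nat \<Rightarrow> rvec" where
  "estimate \<omega> t \<equiv> loss_estimate l t (\<omega> t) (action \<omega> t)"

definition post_grad :: "(nat \<Rightarrow> nat) \<Rightarrow> nat \<Rightarrow> rvec" where
  "post_grad \<omega> t = (\<lambda>i. G (action \<omega> t) i - 1 / \<sigma> t * estimate \<omega> t i)"

definition post :: "(nat \<Rightarrow> nat) \<Rightarrow> nat \<Rightarrow> rvec" where
  "post \<omega> t = grad_conj_bar K \<Psi> (post_grad \<omega> t)"

abbreviation unconstrained_post :: "(nat \<Rightarrow> nat) \<Rightarrow> nat \<Rightarrow> rvec" where
  "unconstrained_post \<omega> t \<equiv> banker_z_tilde K \<Psi> x0 l \<sigma> ord \<omega> t"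

definition mixed_grad :: "(nat \<Rightarrow> nat) \<Rightarrow> nat \<Rightarrow> rvec" where
  "mixed_grad \<omega> t = (\<lambda>i. (\<Sum>s\<in>{1..<t}. sigma_part \<sigma> ord t s / \<sigma> t * G (post \<omega> s) i)
     + investment \<sigma> ord t / \<sigma> t * G x0 i)"

lemma action_unfold: "action \<omega> t = grad_conj_bar K \<Psi> (mixed_grad \<omega> t)"
  by (subst banker_x.simps) (simp add: mixed_grad_def post_def post_grad_def Let_def)

lemma unconstrained_post_unfold: "unconstrained_post \<omega> t = grad_conj K \<Psi> (post_grad \<omega> t)"
  by (simp add: banker_z_tilde_def post_grad_def Let_def)

text \<open>The recursion looks at earlier rounds only, so resampling a round or any later one
  leaves the action distribution of that round unchanged.\<close>

lemma action_cong:
  assumes "\<And>s. s \<in> {1..<t} \<Longrightarrow> \<omega> s = \<omega>' s"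
  shows "action \<omega> t = action \<omega>' t"
  using assms
proof (induction t rule: less_induct)
  case (less t)
  have "post \<omega> s = post \<omega>' s" if "s \<in> {1..<t}" for s
    using that less.IH[of s] less.prems by (simp add: post_def post_grad_def)
  then have "mixed_grad \<omega> t = mixed_grad \<omega>' t" by (simp add: mixed_grad_def)
  then show ?case by (simp add: action_unfold)
qed

text \<open>Sequences of natural numbers may contain indices that are no arms; the law of the run
  gives them probability 0.\<close>

definition legal :: "nat \<Rightarrow> (nat \<Rightarrow> nat) \<Rightarrow> bool" where
  "legal n \<omega> \<longleftrightarrow> (\<forall>s\<in>{1..n}. \<omega> s < K)"

lemma estimate_orthant:
  assumes "t \<in> {1..T}" "\<omega> t < K" "action \<omega> t \<in> positive_orthant K"
  shows "(\<lambda>i. 1 / \<sigma> t * estimate \<omega> t i) \<in> orthant K"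
  using assms losses scale_pos[OF assms(1)] positive_orthantD(2)[OF assms(3,2)]
  by (auto simp: loss_estimate_def orthant_def Rspace_iff bandit_losses_def)

lemma post_grad_Rspace:
  assumes "\<omega> t < K" "action \<omega> t \<in> positive_orthant K"
  shows "post_grad \<omega> t \<in> Rspace K"
  using assms gradient_Rspace[OF assms(2)] by (auto simp: post_grad_def loss_estimate_def Rspace_iff)

lemma post_positive:
  assumes "\<omega> t < K" "action \<omega> t \<in> positive_orthant K"
  shows "post \<omega> t \<in> prob_simplex K" "post \<omega> t \<in> positive_orthant K"
  unfolding post_def by (intro grad_conj_bar[OF x0_simplex x0_positive post_grad_Rspace[OF assms]])+

text \<open>The claims form one induction: the mixed gradient needs positivity of the earlier
  intermediate points, hence of the earlier actions, and in turn yields positivity of the present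
  action.\<close>

lemma action_positive_aux:
  assumes "legal (t - 1) \<omega>"
  shows "mixed_grad \<omega> t \<in> Rspace K \<and> action \<omega> t \<in> prob_simplex K \<and> action \<omega> t \<in> positive_orthant K"
  using assms
proof (induction t rule: less_induct)
  case (less t)
  have "G (post \<omega> s) \<in> Rspace K" if s: "s \<in> {1..<t}" for s
  proof -
    have "\<omega> s < K" "legal (s - 1) \<omega>" using less.prems s by (auto simp: legal_def)
    then show ?thesis using less.IH[of s] s by (intro gradient_Rspace post_positive) auto
  qed
  then have m: "mixed_grad \<omega> t \<in> Rspace K"
    using gradient_Rspace[OF x0_positive] by (auto simp: mixed_grad_def Rspace_iff)
  show ?case
    unfolding action_unfold by (intro conjI m grad_conj_bar(1,2)[OF x0_simplex x0_positive m])
qed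

lemma
  assumes "legal (t - 1) \<omega>"
  shows action_simplex: "action \<omega> t \<in> prob_simplex K"
    and action_positive: "action \<omega> t \<in> positive_orthant K"
    and mixed_grad_Rspace: "mixed_grad \<omega> t \<in> Rspace K"
  using action_positive_aux[OF assms] by simp_all

lemma legal_round:
  assumes "legal T \<omega>" "t \<in> {1..T}"
  shows "legal (t - 1) \<omega>" "\<omega> t < K"
  using assms by (auto simp: legal_def)

text \<open>By the three-point formula, the divergences of \<open>u\<close> and of the action from
  each source point differ by terms linear in its gradient. With weights of total
  \<open>\<sigma> t\<close> these gradients average to the mixed gradient, which acts on
  \<open>u - x\<close> like the gradient of the action \<open>x\<close>. The divergences of the
  action are nonnegative and dropped.\<close>

lemma bregman_action_le:
  assumes \<omega>: "legal T \<omega>" and t: "t \<in> {1..T}" and u: "u \<in> prob_simplex K"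
  shows "\<sigma> t * bregman K \<Psi> u (action \<omega> t) \<le>
    (\<Sum>s\<in>{1..<t}. sigma_part \<sigma> ord t s * bregman K \<Psi> u (post \<omega> s)) +
    investment \<sigma> ord t * bregman K \<Psi> u x0"
proof -
  let ?x = "action \<omega> t" and ?w = "sigma_part \<sigma> ord t" and ?b = "investment \<sigma> ord t"
  let ?D = "bregman K \<Psi>" and ?v = "\<lambda>i. u i - action \<omega> t i"
  note wf = legal_round[OF \<omega> t]
  have x: "?x \<in> prob_simplex K" using wf by (intro action_simplex)
  have "inner_prod K (mixed_grad \<omega> t) ?v = inner_prod K (G ?x) ?v"
    by (rule grad_conj_bar(3)[OF x0_simplex x0_positive mixed_grad_Rspace[OF wf(1)] u x,
          folded action_unfold])
  moreover have "\<sigma> t * inner_prod K (mixed_grad \<omega> t) ?v =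
      (\<Sum>s\<in>{1..<t}. ?w s * inner_prod K (G (post \<omega> s)) ?v) + ?b * inner_prod K (G x0) ?v"
    unfolding mixed_grad_def inner_prod_left(1) inner_prod_sum_left inner_prod_left(3)
      distrib_left sum_distrib_left
    using scale_pos[OF t] by simp
  ultimately have grad: "\<sigma> t * inner_prod K (G ?x) ?v =
      (\<Sum>s\<in>{1..<t}. ?w s * inner_prod K (G (post \<omega> s)) ?v) + ?b * inner_prod K (G x0) ?v"
    by simp
  have split: "c * ?D u z =
      c * ?D ?x z + c * (\<Psi> u - \<Psi> ?x) - c * inner_prod K (G z) ?v" for c z
    unfolding bregman_three_point[of u z ?x] by (simp only: algebra_simps)
  have "(\<Sum>s\<in>{1..<t}. ?w s * ?D u (post \<omega> s)) + ?b * ?D u x0 =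
      ((\<Sum>s\<in>{1..<t}. ?w s * ?D ?x (post \<omega> s)) + ?b * ?D ?x x0) +
      ((\<Sum>s\<in>{1..<t}. ?w s) + ?b) * (\<Psi> u - \<Psi> ?x) -
      ((\<Sum>s\<in>{1..<t}. ?w s * inner_prod K (G (post \<omega> s)) ?v) + ?b * inner_prod K (G x0) ?v)"
    unfolding split sum.distrib sum_subtractf distrib_right sum_distrib_right by simp
  also have "\<dots> = ((\<Sum>s\<in>{1..<t}. ?w s * ?D ?x (post \<omega> s)) + ?b * ?D ?x x0) + \<sigma> t * ?D u ?x"
    unfolding grad[symmetric] sigma_part_sum[OF t] bregman_def[of K \<Psi> u ?x]
    by (simp only: algebra_simps)
  finally have eq: "(\<Sum>s\<in>{1..<t}. ?w s * ?D u (post \<omega> s)) + ?b * ?D u x0 =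
      ((\<Sum>s\<in>{1..<t}. ?w s * ?D ?x (post \<omega> s)) + ?b * ?D ?x x0) + \<sigma> t * ?D u ?x" .
  have "0 \<le> ?D ?x (post \<omega> s)" if s: "s \<in> {1..<t}" for s
  proof -
    have "s \<in> {1..T}" using s t by auto
    from legal_round[OF \<omega> this] show ?thesis
      using prob_simplexD(1)[OF x] by (intro bregman_nonneg post_positive action_positive)
  qed
  then have "0 \<le> (\<Sum>s\<in>{1..<t}. ?w s * ?D ?x (post \<omega> s))"
    using sigma_part_nonneg[OF t] by (intro sum_nonneg mult_nonneg_nonneg) auto
  moreover have "0 \<le> ?b * ?D ?x x0"
    using investment_nonneg[OF t] bregman_nonneg[OF x0_positive prob_simplexD(1)[OF x]] by simp
  ultimately show ?thesis using eq by linarith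
qed

text \<open>Mirror descent usually yields an inequality here; equality holds because the projected
  point is positive.\<close>

lemma step_identity:
  assumes \<omega>: "legal T \<omega>" and t: "t \<in> {1..T}" and u: "u \<in> prob_simplex K"
  shows "inner_prod K (estimate \<omega> t) (\<lambda>i. action \<omega> t i - u i) =
    \<sigma> t * (bregman K \<Psi> u (action \<omega> t) - bregman K \<Psi> u (post \<omega> t) +
      bregman K \<Psi> (action \<omega> t) (post \<omega> t))"
proof -
  let ?x = "action \<omega> t"
  note wf = legal_round[OF \<omega> t]
  note x = action_simplex[OF wf(1)] action_positive[OF wf(1)]
  have "inner_prod K (post_grad \<omega> t) (\<lambda>i. u i - ?x i) = inner_prod K (G (post \<omega> t)) (\<lambda>i. u i - ?x i)"
    unfolding post_def
    by (rule grad_conj_bar(3)[OF x0_simplex x0_positive post_grad_Rspace[OF wf(2) x(2)] u x(1)])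
  then have "inner_prod K (estimate \<omega> t) (\<lambda>i. ?x i - u i) =
      \<sigma> t * (inner_prod K (G (post \<omega> t)) (\<lambda>i. u i - ?x i) - inner_prod K (G ?x) (\<lambda>i. u i - ?x i))"
    using scale_pos[OF t]
    unfolding post_grad_def inner_prod_left inner_prod_right by (simp add: field_simps)
  then show ?thesis
    unfolding bregman_three_point[of u "post \<omega> t" ?x] bregman_def[of K \<Psi> u ?x] by simp
qed

text \<open>Pythagorean identity: \<open>post \<omega> t\<close> is the Bregman projection onto the
  simplex of the unconstrained point, whose gradient is \<open>post_grad \<omega> t\<close>. This
  connects the run with regularity, which speaks of the unconstrained point.\<close>

lemma bregman_post_le:
  assumes \<omega>: "legal T \<omega>" and t: "t \<in> {1..T}"
  shows "bregman K \<Psi> (action \<omega> t) (post \<omega> t) \<le>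
    bregman K \<Psi> (action \<omega> t) (unconstrained_post \<omega> t)"
proof -
  let ?x = "action \<omega> t" and ?z = "post \<omega> t" and ?y = "unconstrained_post \<omega> t"
  note wf = legal_round[OF \<omega> t]
  note x = action_simplex[OF wf(1)] action_positive[OF wf(1)]
  note z = post_positive[OF wf(2) x(2)]
  have y: "?y \<in> positive_orthant K" "G ?y = post_grad \<omega> t"
    unfolding unconstrained_post_unfold unfolding post_grad_def
    using grad_conj[OF x(2) estimate_orthant[of t \<omega>, OF t wf(2) x(2)]] by auto
  have "inner_prod K (G ?y) (\<lambda>i. ?x i - ?z i) = inner_prod K (G ?z) (\<lambda>i. ?x i - ?z i)"
    unfolding y(2) unfolding post_def
    by (rule grad_conj_bar(3)[OF x0_simplex x0_positive post_grad_Rspace[OF wf(2) x(2)] x(1)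
          z(1)[unfolded post_def]])
  then have "bregman K \<Psi> ?x ?y = bregman K \<Psi> ?z ?y + bregman K \<Psi> ?x ?z"
    unfolding bregman_three_point[of ?x ?y ?z] bregman_def[of K \<Psi> ?x ?z] by simp
  then show ?thesis using bregman_nonneg[OF y(1) positive_orthantD(3)[OF z(2)]] by simp
qed

lemma estimated_regret_le:
  assumes \<omega>: "legal T \<omega>" and u: "u \<in> prob_simplex K" and C: "bregman K \<Psi> u x0 \<le> C"
  shows "(\<Sum>t=1..T. inner_prod K (estimate \<omega> t) (\<lambda>i. action \<omega> t i - u i)) \<le>
    total_investment \<sigma> ord T * C +
    (\<Sum>t=1..T. \<sigma> t * bregman K \<Psi> (action \<omega> t) (unconstrained_post \<omega> t))"
proof -
  let ?D = "bregman K \<Psi>" and ?w = "sigma_part \<sigma> ord"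
  have "(\<Sum>t=1..T. inner_prod K (estimate \<omega> t) (\<lambda>i. action \<omega> t i - u i)) \<le>
      (\<Sum>t=1..T. (\<Sum>s\<in>{1..<t}. ?w t s * ?D u (post \<omega> s)) + investment \<sigma> ord t * C -
        \<sigma> t * ?D u (post \<omega> t) + \<sigma> t * ?D (action \<omega> t) (unconstrained_post \<omega> t))"
  proof (rule sum_mono)
    fix t assume t: "t \<in> {1..T}"
    have "\<sigma> t * ?D (action \<omega> t) (post \<omega> t) \<le> \<sigma> t * ?D (action \<omega> t) (unconstrained_post \<omega> t)"
      using bregman_post_le[OF \<omega> t] scale_pos[OF t] by (intro mult_left_mono) auto
    moreover have "investment \<sigma> ord t * ?D u x0 \<le> investment \<sigma> ord t * C"
      using C investment_nonneg[OF t] by (intro mult_left_mono)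
    ultimately show "inner_prod K (estimate \<omega> t) (\<lambda>i. action \<omega> t i - u i) \<le>
      (\<Sum>s\<in>{1..<t}. ?w t s * ?D u (post \<omega> s)) + investment \<sigma> ord t * C -
        \<sigma> t * ?D u (post \<omega> t) + \<sigma> t * ?D (action \<omega> t) (unconstrained_post \<omega> t)"
      using bregman_action_le[OF \<omega> t u] unfolding step_identity[OF \<omega> t u]
      by (simp add: distrib_left right_diff_distrib)
  qed
  also have "\<dots> = (\<Sum>t=1..T. \<Sum>s\<in>{1..<t}. ?w t s * ?D u (post \<omega> s)) + total_investment \<sigma> ord T * C -
      (\<Sum>t=1..T. \<sigma> t * ?D u (post \<omega> t)) +
      (\<Sum>t=1..T. \<sigma> t * ?D (action \<omega> t) (unconstrained_post \<omega> t))"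
    by (simp add: sum.distrib sum_subtractf total_investment_def sum_distrib_right)
  \<comment> \<open>Interchanging the sums collects, for each \<open>s\<close>, all later
    withdrawals from its account. They total at most \<open>\<sigma> s\<close>, so they are covered
    by the negative term of round \<open>s\<close>; this uses that the divergence is
    nonnegative.\<close>
  also have "(\<Sum>t=1..T. \<Sum>s\<in>{1..<t}. ?w t s * ?D u (post \<omega> s)) \<le>
      (\<Sum>s=1..T. \<sigma> s * ?D u (post \<omega> s))"
  proof -
    have "(\<Sum>t=1..T. \<Sum>s\<in>{1..<t}. ?w t s * ?D u (post \<omega> s)) =
        (\<Sum>t=1..T. \<Sum>s | s \<in> {1..T} \<and> s < t. ?w t s * ?D u (post \<omega> s))"
      by (intro sum.cong) auto
    also have "\<dots> = (\<Sum>s=1..T. \<Sum>t | t \<in> {1..T} \<and> s < t. ?w t s * ?D u (post \<omega> s))"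
      by (rule sum.swap_restrict) auto
    also have "\<dots> \<le> (\<Sum>s=1..T. \<sigma> s * ?D u (post \<omega> s))"
    proof (rule sum_mono)
      fix s assume s: "s \<in> {1..T}"
      have "{t. t \<in> {1..T} \<and> s < t} = {s<..T}" using s by auto
      then have "(\<Sum>t | t \<in> {1..T} \<and> s < t. ?w t s * ?D u (post \<omega> s)) =
          (\<Sum>t\<in>{s<..T}. ?w t s) * ?D u (post \<omega> s)"
        by (simp add: sum_distrib_right)
      also have "\<dots> \<le> \<sigma> s * ?D u (post \<omega> s)"
        using legal_round[OF \<omega> s] prob_simplexD(1)[OF u] sigma_part_total_le[OF s]
        by (intro mult_right_mono bregman_nonneg post_positive action_positive)
      finally show "(\<Sum>t | t \<in> {1..T} \<and> s < t. ?w t s * ?D u (post \<omega> s)) \<le> \<sigma> s * ?D u (post \<omega> s)" .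
    qed
    finally show ?thesis .
  qed
  finally show ?thesis by simp
qed

text \<open>Against the action the importance weight cancels and the incurred loss appears; against
  a vertex it remains, to be removed in expectation.\<close>

lemma inner_prod_estimate:
  assumes "action \<omega> t \<in> positive_orthant K" "\<omega> t < K" "i < K"
  shows "inner_prod K (estimate \<omega> t) (\<lambda>j. action \<omega> t j - (if j = i then 1 else 0)) =
    l t (\<omega> t) - (if \<omega> t = i then l t i / action \<omega> t i else 0)"
proof -
  have "estimate \<omega> t = (\<lambda>j. if j = \<omega> t then l t (\<omega> t) / action \<omega> t (\<omega> t) else 0)"
    by (simp add: loss_estimate_def)
  moreover have "action \<omega> t (\<omega> t) \<noteq> 0" using positive_orthantD(2)[OF assms(1,2)] by simp
  ultimately have "inner_prod K (estimate \<omega> t) (action \<omega> t) = l t (\<omega> t)"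
    by (simp add: inner_prod_commute[of K _ "action \<omega> t"] inner_prod_single[OF assms(2)])
  moreover have "inner_prod K (estimate \<omega> t) (\<lambda>j. if j = i then 1 else 0) =
      (if \<omega> t = i then l t i / action \<omega> t i else 0)"
    by (auto simp: inner_prod_single[OF assms(3)] loss_estimate_def)
  ultimately show ?thesis by (simp add: inner_prod_right(2))
qed

section \<open>Expectation over the random actions\<close>

abbreviation law :: "nat \<Rightarrow> (nat \<Rightarrow> nat) pmf" where
  "law \<equiv> banker_law K \<Psi> x0 l \<sigma> ord"

lemma pmf_embed_simplex:
  assumes "x \<in> prob_simplex K"
  shows "pmf (embed_pmf x) i = x i" "set_pmf (embed_pmf x) \<subseteq> {..<K}"
proof -
  have nonneg: "0 \<le> x i" for i
    using assms by (cases "i < K") (auto simp: prob_simplex_def Rspace_iff)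
  have "(\<integral>\<^sup>+ i. ennreal (x i) \<partial>count_space UNIV) = (\<Sum>i<K. ennreal (x i))"
    using assms by (intro nn_integral_count_space') (auto simp: prob_simplex_def Rspace_iff not_less)
  also have "\<dots> = 1" using prob_simplexD(3)[OF assms] nonneg by (simp add: sum_ennreal)
  finally show pmf: "pmf (embed_pmf x) i = x i" for i
    using nonneg by (intro pmf_embed_pmf) auto
  show "set_pmf (embed_pmf x) \<subseteq> {..<K}"
    using assms by (auto simp: set_pmf_eq pmf prob_simplex_def Rspace_iff not_less[symmetric])
qed

text \<open>Finite support settles every question of integrability, and legality makes the pathwise
  estimates hold almost surely.\<close>

lemma law_support: "finite (set_pmf (law n)) \<and> (\<forall>\<omega>\<in>set_pmf (law n). legal n \<omega>)"
proof (induction n)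
  case (Suc n)
  have supp: "set_pmf (embed_pmf (action \<omega> (Suc n))) \<subseteq> {..<K}" if "\<omega> \<in> set_pmf (law n)" for \<omega>
    using Suc that by (intro pmf_embed_simplex action_simplex) auto
  have "finite (set_pmf (embed_pmf (action \<omega> (Suc n))))" if "\<omega> \<in> set_pmf (law n)" for \<omega>
    using supp[OF that] finite_subset by blast
  then have "finite (set_pmf (law (Suc n)))" using Suc by simp
  moreover have "legal (Suc n) \<omega>" if "\<omega> \<in> set_pmf (law (Suc n))" for \<omega>
  proof -
    obtain \<omega>' a where \<omega>': "\<omega>' \<in> set_pmf (law n)" "a \<in> set_pmf (embed_pmf (action \<omega>' (Suc n)))"
        "\<omega> = fun_upd \<omega>' (Suc n) a"
      using \<open>\<omega> \<in> set_pmf (law (Suc n))\<close> by auto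
    then have "a < K" "legal n \<omega>'" using supp Suc by auto
    then show ?thesis using \<omega>'(3) by (auto simp: legal_def)
  qed
  ultimately show ?case by blast
qed (simp add: legal_def)

lemma integrable_law: "integrable (measure_pmf (law n)) (f :: _ \<Rightarrow> real)"
  using law_support by (intro integrable_measure_pmf_finite) blast

text \<open>Rounds after \<open>t\<close> only overwrite coordinates that \<open>f\<close> ignores,
  so \<open>f\<close> has the same distribution under both laws.\<close>

lemma expectation_law_past:
  fixes f :: "(nat \<Rightarrow> nat) \<Rightarrow> real"
  assumes "t \<le> n" "\<And>\<omega> s a. t < s \<Longrightarrow> f (fun_upd \<omega> s a) = f \<omega>"
  shows "measure_pmf.expectation (law n) f = measure_pmf.expectation (law t) f"
  using assms(1)
proof (induction n rule: dec_induct)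
  case (step n)
  have "map_pmf f (law (Suc n)) = map_pmf f (law n)"
    using step assms(2)[of "Suc n"]
    by (simp add: map_bind_pmf pmf.map_comp o_def map_pmf_const bind_return_pmf' flip: map_pmf_def)
  then have "measure_pmf.expectation (map_pmf f (law (Suc n))) (\<lambda>x. x) =
      measure_pmf.expectation (map_pmf f (law n)) (\<lambda>x. x)" by simp
  then show ?case using step.IH unfolding integral_map_pmf by simp
qed simp

text \<open>Given the past, arm \<open>i\<close> is drawn with probability
  \<open>action \<omega> t i\<close>, which cancels the weight. By \<open>act\<close> the weight is
  the same before and after the draw.\<close>

lemma expectation_importance_weight:
  assumes t: "t \<in> {1..T}" and i: "i < K"
  shows "measure_pmf.expectation (law T) (\<lambda>\<omega>. if \<omega> t = i then c / action \<omega> t i else 0) = c"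
proof -
  obtain m where m: "t = Suc m" using t by (cases t) auto
  let ?f = "\<lambda>\<omega>. if \<omega> t = i then c / action \<omega> t i else 0"
  let ?Q = "\<lambda>\<omega>. embed_pmf (action \<omega> (Suc m))"
  have act: "action (fun_upd \<omega> s a) t = action \<omega> t" if "t \<le> s" for \<omega> s a
    using that by (intro action_cong) auto
  have simplex: "action \<omega> (Suc m) \<in> prob_simplex K" if "\<omega> \<in> set_pmf (law m)" for \<omega>
    using that law_support by (intro action_simplex) auto
  have fin: "finite (set_pmf (?Q \<omega>))" if "\<omega> \<in> set_pmf (law m)" for \<omega>
    using pmf_embed_simplex(2)[OF simplex[OF that]] finite_subset by blast
  have "measure_pmf.expectation (law T) ?f = measure_pmf.expectation (law t) ?f"
    using t act by (intro expectation_law_past) auto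
  also have "\<dots> = (\<Sum>\<omega>\<in>set_pmf (law m). pmf (law m) \<omega> *\<^sub>R
      measure_pmf.expectation (map_pmf (fun_upd \<omega> (Suc m)) (?Q \<omega>)) ?f)"
    unfolding m banker_law.simps using fin law_support by (intro pmf_expectation_bind) auto
  also have "\<dots> = (\<Sum>\<omega>\<in>set_pmf (law m). pmf (law m) \<omega> * c)"
  proof (intro sum.cong refl)
    fix \<omega> assume \<omega>: "\<omega> \<in> set_pmf (law m)"
    have pos: "0 < action \<omega> t i"
      using \<omega> law_support i unfolding m by (intro positive_orthantD(2)[OF action_positive]) auto
    have "measure_pmf.expectation (map_pmf (fun_upd \<omega> (Suc m)) (?Q \<omega>)) ?f =
        measure_pmf.expectation (?Q \<omega>) (\<lambda>a. if a = i then c / action \<omega> t i else 0)"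
      using act by (simp add: m cong: if_cong)
    also have "\<dots> = (\<Sum>a\<in>{i}. (if a = i then c / action \<omega> t i else 0) * pmf (?Q \<omega>) a)"
      by (intro integral_measure_pmf_real) (auto split: if_splits)
    also have "\<dots> = c" using pmf_embed_simplex(1)[OF simplex[OF \<omega>]] pos by (simp add: m)
    finally show "pmf (law m) \<omega> *\<^sub>R
        measure_pmf.expectation (map_pmf (fun_upd \<omega> (Suc m)) (?Q \<omega>)) ?f = pmf (law m) \<omega> * c"
      by simp
  qed
  also have "\<dots> = c"
    using law_support by (simp add: sum_pmf_eq_1 flip: sum_distrib_right)
  finally show ?thesis .
qed

text \<open>A conditional expectation has the expectation of the function itself, so integrating the
  conditional bound suffices. Every set is measurable under a discrete law, hence the feedback
  algebra is a subalgebra.\<close>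

lemma regular_expectation_le:
  assumes "regular K T l d ord \<sigma> \<Psi> x0 C1 C2" "t \<in> {1..T}"
  shows "measure_pmf.expectation (law T)
    (\<lambda>\<omega>. \<sigma> t * bregman K \<Psi> (action \<omega> t) (unconstrained_post \<omega> t)) \<le> C2 / \<sigma> t"
proof -
  let ?P = "measure_pmf (law T)" and ?F = "feedback_algebra l d (t - 1)"
  let ?f = "\<lambda>\<omega>. \<sigma> t * bregman K \<Psi> (action \<omega> t) (unconstrained_post \<omega> t)"
  have "space ?F = UNIV" by (simp add: feedback_algebra_def space_measure_of_conv)
  then have "subalgebra ?P ?F" by (simp add: subalgebra_def)
  then interpret sigma_finite_subalgebra ?P ?F
    by (intro finite_measure_subalgebra_is_sigma_finite) (unfold_locales, auto)
  have "AE \<omega> in ?P. real_cond_exp ?P ?F ?f \<omega> \<le> C2 / \<sigma> t"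
    using assms unfolding regular_def Let_def by blast
  then have "(\<integral>\<omega>. real_cond_exp ?P ?F ?f \<omega> \<partial>?P) \<le> (\<integral>\<omega>. C2 / \<sigma> t \<partial>?P)"
    by (intro integral_mono_AE integrable_law)
  then show ?thesis using real_cond_exp_int(2)[OF integrable_law] by simp
qed

text \<open>Competing with an arm is competing with a vertex of the simplex. In expectation the
  importance weights turn the estimated losses of the arm into its true ones, so the pathwise bound
  passes to the regret.\<close>

lemma pseudo_regret_le:
  assumes reg: "regular K T l d ord \<sigma> \<Psi> x0 C1 C2"
  shows "pseudo_regret K T l (law T) \<le>
    total_investment \<sigma> ord T * C1 + (\<Sum>t=1..T. C2 / \<sigma> t)"
proof -
  let ?E = "measure_pmf.expectation (law T)"
  let ?W = "\<lambda>\<omega> t i. if \<omega> t = i then l t i / action \<omega> t i else 0"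
  have "?E (\<lambda>\<omega>. (\<Sum>t=1..T. l t (\<omega> t)) - (\<Sum>t=1..T. l t i)) \<le>
      total_investment \<sigma> ord T * C1 + (\<Sum>t=1..T. C2 / \<sigma> t)" if i: "i < K" for i
  proof -
    let ?u = "\<lambda>j::nat. if j = i then 1 else 0 :: real"
    have u: "?u \<in> prob_simplex K" by (rule prob_simplex_vertex[OF i])
    have C: "bregman K \<Psi> ?u x0 \<le> C1" using reg u by (simp add: regular_def)
    have "?E (\<lambda>\<omega>. (\<Sum>t=1..T. l t (\<omega> t)) - (\<Sum>t=1..T. l t i)) =
        (\<Sum>t=1..T. ?E (\<lambda>\<omega>. l t (\<omega> t))) - (\<Sum>t=1..T. l t i)"
      by (simp add: integrable_law)
    also have "\<dots> = (\<Sum>t=1..T. ?E (\<lambda>\<omega>. l t (\<omega> t))) - (\<Sum>t=1..T. ?E (\<lambda>\<omega>. ?W \<omega> t i))"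
      using expectation_importance_weight i by simp
    also have "\<dots> = ?E (\<lambda>\<omega>. \<Sum>t=1..T. l t (\<omega> t) - ?W \<omega> t i)"
      by (simp add: integrable_law sum_subtractf)
    also have "\<dots> \<le> ?E (\<lambda>\<omega>. total_investment \<sigma> ord T * C1 +
        (\<Sum>t=1..T. \<sigma> t * bregman K \<Psi> (action \<omega> t) (unconstrained_post \<omega> t)))"
    proof (intro integral_mono_AE integrable_law, unfold AE_measure_pmf_iff, rule ballI)
      fix \<omega> assume "\<omega> \<in> set_pmf (law T)"
      then have \<omega>: "legal T \<omega>" using law_support by blast
      have "(\<Sum>t=1..T. l t (\<omega> t) - ?W \<omega> t i) =
          (\<Sum>t=1..T. inner_prod K (estimate \<omega> t) (\<lambda>j. action \<omega> t j - ?u j))"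
        using legal_round[OF \<omega>] action_positive i
        by (intro sum.cong refl inner_prod_estimate[symmetric]) auto
      also have "\<dots> \<le> total_investment \<sigma> ord T * C1 +
          (\<Sum>t=1..T. \<sigma> t * bregman K \<Psi> (action \<omega> t) (unconstrained_post \<omega> t))"
        by (rule estimated_regret_le[OF \<omega> u C])
      finally show "(\<Sum>t=1..T. l t (\<omega> t) - ?W \<omega> t i) \<le> total_investment \<sigma> ord T * C1 +
          (\<Sum>t=1..T. \<sigma> t * bregman K \<Psi> (action \<omega> t) (unconstrained_post \<omega> t))" .
    qed
    also have "\<dots> = total_investment \<sigma> ord T * C1 +
        (\<Sum>t=1..T. ?E (\<lambda>\<omega>. \<sigma> t * bregman K \<Psi> (action \<omega> t) (unconstrained_post \<omega> t)))"
      by (subst Bochner_Integration.integral_add[OF integrable_law integrable_law],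
          subst Bochner_Integration.integral_sum[OF integrable_law]) simp
    also have "\<dots> \<le> total_investment \<sigma> ord T * C1 + (\<Sum>t=1..T. C2 / \<sigma> t)"
      using regular_expectation_le[OF reg] by (intro add_left_mono sum_mono)
    finally show ?thesis .
  qed
  \<comment> \<open>For \<open>K = 0\<close> the simplex would be empty; thus the maximum ranges
    over a nonempty set.\<close>
  moreover have "0 < K"
    using prob_simplexD(3)[OF x0_simplex] by (cases "K = 0") auto
  ultimately show ?thesis
    unfolding pseudo_regret_def by (intro Max.boundedI) auto
qed

end

theorem theorem4p6:
  shows
    "(\<exists>c>0. \<forall>K T l d ord \<Psi> x0 \<sigma>.
        K \<ge> 2 \<and> T \<ge> 1 \<and> bandit_losses K T l \<and> processing_order T d ord \<and>
        banker_input K \<Psi> x0 \<and>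
        (\<forall>t\<in>{1..T}. \<sigma> t =
           inverse (1 / sqrt (real t) + real (missing d t) *
             sqrt (ln (real (missing_sum d t) + 1) / real (missing_sum d t)))) \<longrightarrow>
        total_investment \<sigma> ord T
          \<le> c * (sqrt (real T) + sqrt (real (total_delay T d) * ln (real (total_delay T d))))) \<and>
     (\<exists>c>0. \<forall>K T l d ord \<Psi> x0 \<sigma> C1 C2.
        K \<ge> 2 \<and> T \<ge> 1 \<and> bandit_losses K T l \<and> processing_order T d ord \<and>
        banker_input K \<Psi> x0 \<and>
        (\<forall>t\<in>{1..T}. \<sigma> t = sqrt (C2 / C1) *
           inverse (1 / sqrt (real t) + real (missing d t) *
             sqrt (ln (real (missing_sum d t) + 1) / real (missing_sum d t)))) \<and>
        regular K T l d ord \<sigma> \<Psi> x0 C1 C2 \<longrightarrow>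
        pseudo_regret K T l (banker_law K \<Psi> x0 l \<sigma> ord T)
          \<le> c * (sqrt (C1 * C2) *
              (sqrt (real T) + sqrt (real (total_delay T d) * ln (real (total_delay T d))))))"
proof (intro conjI)
  let ?X = "\<lambda>T d. sqrt (real T) + sqrt (real (total_delay T d) * ln (real (total_delay T d)))"
  have part1: "total_investment \<sigma> ord T \<le> 6 * ?X T d"
    if "T \<ge> 1" "processing_order T d ord" "\<forall>t\<in>{1..T}. \<sigma> t = inverse (rate d t)"
    for T d ord \<sigma>
  proof -
    interpret banker_bookkeeping T d ord \<sigma>
      using that rate_pos[of _ d] by unfold_locales auto
    show ?thesis using total_investment_rate[OF that(1), of 1] that(3) by simp
  qed
  then show "\<exists>c>0. \<forall>K T l d ord \<Psi> x0 \<sigma>.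
        K \<ge> 2 \<and> T \<ge> 1 \<and> bandit_losses K T l \<and> processing_order T d ord \<and>
        banker_input K \<Psi> x0 \<and> (\<forall>t\<in>{1..T}. \<sigma> t = inverse (rate d t)) \<longrightarrow>
        total_investment \<sigma> ord T \<le> c * ?X T d"
    by (intro exI[of _ 6]) simp
  have part2: "pseudo_regret K T l (banker_law K \<Psi> x0 l \<sigma> ord T) \<le> 12 * (sqrt (C1 * C2) * ?X T d)"
    if T: "T \<ge> 1" and losses: "bandit_losses K T l" and order: "processing_order T d ord"
      and input: "banker_input K \<Psi> x0"
      and \<sigma>: "\<forall>t\<in>{1..T}. \<sigma> t = sqrt (C2 / C1) * inverse (rate d t)"
      and reg: "regular K T l d ord \<sigma> \<Psi> x0 C1 C2"
    for K T l d ord \<Psi> x0 \<sigma> C1 C2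
  proof -
    have C: "0 < C1" "0 < C2" using reg by (auto simp: regular_def)
    define \<kappa> where "\<kappa> = sqrt (C2 / C1)"
    have \<kappa>: "0 < \<kappa>" using C by (simp add: \<kappa>_def)
    have \<sigma>': "\<sigma> t = \<kappa> * inverse (rate d t)" if "t \<in> {1..T}" for t
      using \<sigma> that by (simp add: \<kappa>_def)
    interpret banker_bookkeeping T d ord \<sigma>
    proof
      show "0 < \<sigma> t" if "t \<in> {1..T}" for t
        using \<sigma>'[OF that] \<kappa> rate_pos[of t d] that by simp
    qed (rule order)
    interpret legendre_orthant K \<Psi>
      using input by unfold_locales (simp add: banker_input_def)
    interpret banker_run T d ord \<sigma> K \<Psi> x0 l
      using losses input has_gradient_imp_positive
      by unfold_locales (auto simp: banker_input_def)
    \<comment> \<open>The normalization balances the two parts of the regret: investment and local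
      terms both get the coefficient \<open>sqrt (C1 * C2)\<close>, and each contributes 6 to the
      constant 12.\<close>
    have scale: "\<kappa> * C1 = sqrt (C1 * C2)" "C2 / \<kappa> = sqrt (C1 * C2)"
      using C by (simp_all add: \<kappa>_def real_sqrt_mult real_sqrt_divide field_simps)
    have "(\<Sum>t=1..T. C2 / \<sigma> t) = (\<Sum>t=1..T. C2 / \<kappa> * rate d t)"
    proof (rule sum.cong[OF refl])
      fix t assume t: "t \<in> {1..T}"
      then have "0 < rate d t" by (intro rate_pos) simp
      then show "C2 / \<sigma> t = C2 / \<kappa> * rate d t"
        unfolding \<sigma>'[OF t] using \<kappa> by (metis divide_divide_eq_left divide_inverse inverse_inverse_eq)
    qed
    also have "\<dots> \<le> sqrt (C1 * C2) * (6 * ?X T d)"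
      unfolding scale sum_distrib_left[symmetric] using C by (intro mult_left_mono sum_rate_le T) auto
    finally have "(\<Sum>t=1..T. C2 / \<sigma> t) \<le> sqrt (C1 * C2) * (6 * ?X T d)" .
    moreover have "total_investment \<sigma> ord T * C1 \<le> sqrt (C1 * C2) * (6 * ?X T d)"
    proof -
      have "total_investment \<sigma> ord T * C1 \<le> \<kappa> * (6 * ?X T d) * C1"
        using total_investment_rate[OF T \<kappa> \<sigma>'] C by (intro mult_right_mono) auto
      also have "\<dots> = \<kappa> * C1 * (6 * ?X T d)" by (simp only: mult_ac)
      finally show ?thesis unfolding scale .
    qed
    ultimately show ?thesis using pseudo_regret_le[OF reg] by linarith
  qed
  then show "\<exists>c>0. \<forall>K T l d ord \<Psi> x0 \<sigma> C1 C2.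
        K \<ge> 2 \<and> T \<ge> 1 \<and> bandit_losses K T l \<and> processing_order T d ord \<and>
        banker_input K \<Psi> x0 \<and>
        (\<forall>t\<in>{1..T}. \<sigma> t = sqrt (C2 / C1) * inverse (rate d t)) \<and>
        regular K T l d ord \<sigma> \<Psi> x0 C1 C2 \<longrightarrow>
        pseudo_regret K T l (banker_law K \<Psi> x0 l \<sigma> ord T) \<le> c * (sqrt (C1 * C2) * ?X T d)"
    by (intro exI[of _ 12] conjI allI impI) (simp, blast)
qed

end
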